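(* Let $m,n\ge 2$ and let $S=S(m,n;\underline{t})$ be the special Lie superalgebra over a field $\mathbb{F}$ of characteristic $p>2$. Let $\phi$ be a skew-symmetric super-biderivation of $S$. For any $k_0,i_0,j_0\in Y_0$, $k_1\in Y_1$ with $i_0\neq k_0$ and $j_0\neq i_0$, there is an element $\lambda_{k_0k_1i_0}\in\mathbb{F}$, depending (for given $\phi$) only on $k_0$, $k_1$ and $i_0$, such that $$\phi(D_{k_0k_1}(x_{k_0}x_{k_1}),D_{i_0j_0}(x_{j_0}x_{k_1}))=\lambda_{k_0k_1i_0}[D_{k_0k_1}(x_{k_0}x_{k_1}),D_{i_0j_0}(x_{j_0}x_{k_1})].$$
   Context: Conventions. $\mathbb{F}$ is a field of characteristic $p>2$; $\mathbb{Z}_2=\{\bar 0,\bar 1\}$; $\mathrm{d}(x)$ denotes the $\mathbb{Z}_2$-degree (parity) of $x$, and whenever $\mathrm{d}(x)$ appears, $x$ is assumed $\mathbb{Z}_2$-homogeneous. A Lie superalgebra is a superspace $L=L_{\bar 0}\oplus L_{\bar 1}$ with an even bilinear bracket satisfying $[x,y]=-(-1)^{\mathrm{d}(x)\mathrm{d}(y)}[y,x]$ and $[x,[y,z]]=[[x,y],z]+(-1)^{\mathrm{d}(x)\mathrm{d}(y)}[y,[x,z]]$. Super-biderivations. A bilinear map $\phi:L\times L\to L$ is $\mathbb{Z}_2$-homogeneous of degree $\gamma=\mathrm{d}(\phi)\in\mathbb{Z}_2$ if $\phi(L_\alpha,L_\beta)\subset L_{\alpha+\beta+\gamma}$ for all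 $\alpha,\beta\in\mathbb{Z}_2$. A homogeneous bilinear map $\phi$ is a skew-symmetric super-biderivation of $L$ if for all homogeneous $x,y,z\in L$ $$\phi(x,[y,z])=[\phi(x,y),z]+(-1)^{(\mathrm{d}(\phi)+\mathrm{d}(x))\mathrm{d}(y)}[y,\phi(x,z)],$$ $$\phi(x,y)=-(-1)^{\mathrm{d}(\phi)\mathrm{d}(x)+\mathrm{d}(\phi)\mathrm{d}(y)+\mathrm{d}(x)\mathrm{d}(y)}\phi(y,x).$$ The algebra $S(m,n;\underline{t})$. Let $\underline{t}=(t_1,\dots,t_m)$ be an $m$-tuple of positive integers, $s=m+n$, $Y_0=\{1,\dots,m\}$, $Y_1=\{m+1,\dots,s\}$, $Y=Y_0\cup Y_1$, and $\tau(i)=\bar 0$ for $i\in Y_0$, $\tau(i)=\bar 1$ for $i\in Y_1$. Let $\pi_i=p^{t_i}-1$ and $A=\{\alpha\in\mathbb{N}^m\mid 0\le\alpha_i\le\pi_i\}$; let $B$ be the set of strictly increasing tuples $u=\langle i_1,\dots,i_k\rangle$ in $Y_1$ ($0\le k\le n$), with $x^u=x_{i_1}\cdots x_{i_k}$ and $x^{\varnothing}=1$. Let $\Lambda(m,n;\underline{t})$ be the associative superalgebra with basis $\{x^{(\alpha)}x^u\mid\alpha\in A,u\in B\}$, where $x^{(\alpha)}x^{(\beta)}=\binom{\alpha+\beta}{\alpha}x^{(\alpha+\beta)}$ with $\binom{\alpha}{\beta}=\prod_i\binom{\alpha_i}{\beta_i}$ (the product is $0$ when $\alpha+\beta\notin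 A$), $x_ix_j=-x_jx_i$ for $i,j\in Y_1$ (so $x_i^2=0$), $x^{(\alpha)}x_j=x_jx^{(\alpha)}$ for $j\in Y_1$; the $x^{(\alpha)}$ are even and the $x_j$, $j\in Y_1$, odd. For $i\in Y_0$ write $x_i=x^{(\varepsilon_i)}$, with $\varepsilon_i$ the $i$-th unit vector. Let $D_i$ ($i\in Y$) be the superderivation of parity $\tau(i)$ given by $D_i(x^{(\alpha)}x^u)=x^{(\alpha-\varepsilon_i)}x^u$ for $i\in Y_0$ (zero if $\alpha_i=0$), and $D_i(x^{(\alpha)}x^u)=x^{(\alpha)}\partial_i(x^u)$ for $i\in Y_1$, where $\partial_i$ is the odd superderivation of the Grassmann algebra with $\partial_i(x_j)=\delta_{ij}$. Let $W(m,n;\underline{t})=\{\sum_{i\in Y}f_iD_i\mid f_i\in\Lambda(m,n;\underline{t})\}$ with bracket $[fD_i,gD_j]=fD_i(g)D_j-(-1)^{\mathrm{d}(fD_i)\mathrm{d}(gD_j)}gD_j(f)D_i$. For $i,j\in Y$ and homogeneous $f\in\Lambda(m,n;\underline{t})$ put $$D_{ij}(f)=-(-1)^{\mathrm{d}(f)(\tau(i)+\tau(j))}D_j(f)D_i+(-1)^{\tau(i)\tau(j)}D_i(f)D_j,$$ extended linearly in $f$. Then $S=S(m,n;\underline{t})=\mathrm{span}_{\mathbb{F}}\{D_{ij}(f)\mid i,j\in Y,\ f\in\Lambda(m,n;\underline{t})\}$, a finite-dimensional simple Lie sub-superalgebra of $W(m,n;\underline{t})$. *)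

theory Defs
  imports Complex_Main "HOL-Library.Z2" "HOL-Library.Function_Algebras"
begin

text \<open>Parities are elements of the two-element field \<^typ>\<open>bit\<close>; \<open>sg a\<close> is the sign $(-1)^a$.\<close>

definition sg :: "bit \<Rightarrow> 'a::field" where
  "sg a = (if a = 0 then 1 else - 1)"


section \<open>Skew-symmetric super-biderivations\<close>

text \<open>
  \<open>V\<close> is the underlying space of a Lie superalgebra, \<open>G a\<close> its homogeneous part of parity \<open>a\<close>,
  \<open>smul\<close> the scalar multiplication and \<open>br\<close> the bracket. Only the values of \<open>\<phi>\<close> on
  \<open>V \<times> V\<close> matter. The zero vector lies in both homogeneous parts.
\<close>

definition bilinear_on ::
  "('a::field \<Rightarrow> 'v::ab_group_add \<Rightarrow> 'v) \<Rightarrow> 'v set \<Rightarrow> ('v \<Rightarrow> 'v \<Rightarrow> 'v) \<Rightarrow> bool" where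
  "bilinear_on smul V \<phi> \<longleftrightarrow>
     (\<forall>x\<in>V. \<forall>y\<in>V. \<phi> x y \<in> V) \<and>
     (\<forall>x\<in>V. \<forall>y\<in>V. \<forall>z\<in>V. \<phi> (x + y) z = \<phi> x z + \<phi> y z) \<and>
     (\<forall>x\<in>V. \<forall>y\<in>V. \<forall>z\<in>V. \<phi> x (y + z) = \<phi> x y + \<phi> x z) \<and>
     (\<forall>c. \<forall>x\<in>V. \<forall>y\<in>V. \<phi> (smul c x) y = smul c (\<phi> x y)) \<and>
     (\<forall>c. \<forall>x\<in>V. \<forall>y\<in>V. \<phi> x (smul c y) = smul c (\<phi> x y))"

definition homogeneous_of_degree ::
  "(bit \<Rightarrow> 'v set) \<Rightarrow> bit \<Rightarrow> ('v \<Rightarrow> 'v \<Rightarrow> 'v) \<Rightarrow> bool" where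
  "homogeneous_of_degree G \<gamma> \<phi> \<longleftrightarrow>
     (\<forall>a b. \<forall>x\<in>G a. \<forall>y\<in>G b. \<phi> x y \<in> G (a + b + \<gamma>))"

definition skew_super_biderivation ::
  "('a::field \<Rightarrow> 'v::ab_group_add \<Rightarrow> 'v) \<Rightarrow> 'v set \<Rightarrow> (bit \<Rightarrow> 'v set) \<Rightarrow> ('v \<Rightarrow> 'v \<Rightarrow> 'v) \<Rightarrow>
   ('v \<Rightarrow> 'v \<Rightarrow> 'v) \<Rightarrow> bool" where
  "skew_super_biderivation smul V G br \<phi> \<longleftrightarrow>
     bilinear_on smul V \<phi> \<and>
     (\<exists>\<gamma>. homogeneous_of_degree G \<gamma> \<phi> \<and>
        (\<forall>a b c. \<forall>x\<in>G a. \<forall>y\<in>G b. \<forall>z\<in>G c.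
           \<phi> x (br y z) = br (\<phi> x y) z + smul (sg ((\<gamma> + a) * b)) (br y (\<phi> x z))) \<and>
        (\<forall>a b. \<forall>x\<in>G a. \<forall>y\<in>G b.
           \<phi> x y = - smul (sg (\<gamma> * a + \<gamma> * b + a * b)) (\<phi> y x)))"


section \<open>The algebra \<open>\<Lambda>(m,n;t)\<close>\<close>

definition Y0 :: "nat \<Rightarrow> nat set" where
  "Y0 m = {1..m}"

definition Y1 :: "nat \<Rightarrow> nat \<Rightarrow> nat set" where
  "Y1 m n = {m+1..m+n}"

definition Y :: "nat \<Rightarrow> nat \<Rightarrow> nat set" where
  "Y m n = Y0 m \<union> Y1 m n"

definition tau :: "nat \<Rightarrow> nat \<Rightarrow> bit" where
  "tau m i = (if i \<in> Y0 m then 0 else 1)"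

text \<open>
  The tuple $(t_1,\dots,t_m)$ is a function of which only the values on \<open>Y0 m\<close> are used; multi-indices
  vanish outside \<open>Y0 m\<close>. A strictly increasing tuple \<open>u\<close> in \<open>Y1 m n\<close> is encoded by the set of its
  entries. A pair \<open>(\<alpha>, u)\<close> stands for the basis element $x^{(\alpha)}x^u$.
\<close>

type_synonym idx = "(nat \<Rightarrow> nat) \<times> nat set"

definition A :: "nat \<Rightarrow> nat \<Rightarrow> (nat \<Rightarrow> nat) \<Rightarrow> (nat \<Rightarrow> nat) set" where
  "A p m t = {\<alpha>. (\<forall>i\<in>Y0 m. \<alpha> i \<le> p ^ t i - 1) \<and> (\<forall>i. i \<notin> Y0 m \<longrightarrow> \<alpha> i = 0)}"

definition B :: "nat \<Rightarrow> nat \<Rightarrow> nat set set" where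
  "B m n = Pow (Y1 m n)"

definition basis :: "nat \<Rightarrow> nat \<Rightarrow> nat \<Rightarrow> (nat \<Rightarrow> nat) \<Rightarrow> idx set" where
  "basis p m n t = A p m t \<times> B m n"

text \<open>
  Elements are coefficient functions with respect to this basis. Addition of such functions is
  pointwise; the pointwise multiplication of functions is never used.
\<close>

definition Lam :: "nat \<Rightarrow> nat \<Rightarrow> nat \<Rightarrow> (nat \<Rightarrow> nat) \<Rightarrow> (idx \<Rightarrow> 'a::field) set" where
  "Lam p m n t = {f. \<forall>b. b \<notin> basis p m n t \<longrightarrow> f b = 0}"

definition lscale :: "'a::field \<Rightarrow> (idx \<Rightarrow> 'a) \<Rightarrow> (idx \<Rightarrow> 'a)" where
  "lscale c f = (\<lambda>b. c * f b)"

definition xmono :: "(nat \<Rightarrow> nat) \<Rightarrow> nat set \<Rightarrow> (idx \<Rightarrow> 'a::field)" where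
  "xmono \<alpha> u = (\<lambda>b. if b = (\<alpha>, u) then 1 else 0)"

definition eps :: "nat \<Rightarrow> (nat \<Rightarrow> nat)" where
  "eps i = (\<lambda>j. if j = i then 1 else 0)"

definition gen :: "nat \<Rightarrow> nat \<Rightarrow> (idx \<Rightarrow> 'a::field)" where
  "gen m i = (if i \<in> Y0 m then xmono (eps i) {} else xmono 0 {i})"

text \<open>
  Sorting the concatenation of the increasing tuples \<open>u\<close> and \<open>v\<close> takes as many transpositions of
  anticommuting generators as there are inversions; a common generator makes the product vanish.
\<close>

definition mono_mult ::
  "nat \<Rightarrow> nat \<Rightarrow> (nat \<Rightarrow> nat) \<Rightarrow> idx \<Rightarrow> idx \<Rightarrow> (idx \<Rightarrow> 'a::field)" where
  "mono_mult p m t = (\<lambda>(\<alpha>, u) (\<beta>, v).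
     if \<alpha> + \<beta> \<in> A p m t \<and> u \<inter> v = {}
     then lscale (of_nat (\<Prod>i\<in>Y0 m. (\<alpha> i + \<beta> i) choose \<alpha> i) *
                  (- 1) ^ card {(i, j). i \<in> u \<and> j \<in> v \<and> j < i})
            (xmono (\<alpha> + \<beta>) (u \<union> v))
     else 0)"

definition lmult ::
  "nat \<Rightarrow> nat \<Rightarrow> nat \<Rightarrow> (nat \<Rightarrow> nat) \<Rightarrow> (idx \<Rightarrow> 'a::field) \<Rightarrow> (idx \<Rightarrow> 'a) \<Rightarrow> (idx \<Rightarrow> 'a)" where
  "lmult p m n t f g =
     (\<Sum>b\<in>basis p m n t. \<Sum>c\<in>basis p m n t. lscale (f b * g c) (mono_mult p m t b c))"

definition idx_parity :: "idx \<Rightarrow> bit" where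
  "idx_parity b = of_nat (card (snd b))"

definition Lam_hom ::
  "nat \<Rightarrow> nat \<Rightarrow> nat \<Rightarrow> (nat \<Rightarrow> nat) \<Rightarrow> bit \<Rightarrow> (idx \<Rightarrow> 'a::field) set" where
  "Lam_hom p m n t a = {f \<in> Lam p m n t. \<forall>b. f b \<noteq> 0 \<longrightarrow> idx_parity b = a}"

definition hpart :: "bit \<Rightarrow> (idx \<Rightarrow> 'a::field) \<Rightarrow> (idx \<Rightarrow> 'a)" where
  "hpart a f = (\<lambda>b. if idx_parity b = a then f b else 0)"

text \<open>
  For odd \<open>i\<close> the sign comes from moving $\partial_i$ past the generators in front of $x_i$.
\<close>

definition D_mono :: "nat \<Rightarrow> nat \<Rightarrow> idx \<Rightarrow> (idx \<Rightarrow> 'a::field)" where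
  "D_mono m i = (\<lambda>(\<alpha>, u).
     if i \<in> Y0 m
     then (if \<alpha> i = 0 then 0 else xmono (\<alpha> - eps i) u)
     else (if i \<in> u then lscale ((- 1) ^ card {j \<in> u. j < i}) (xmono \<alpha> (u - {i})) else 0))"

definition D ::
  "nat \<Rightarrow> nat \<Rightarrow> nat \<Rightarrow> (nat \<Rightarrow> nat) \<Rightarrow> nat \<Rightarrow> (idx \<Rightarrow> 'a::field) \<Rightarrow> (idx \<Rightarrow> 'a)" where
  "D p m n t i f = (\<Sum>b\<in>basis p m n t. lscale (f b) (D_mono m i b))"


section \<open>The Lie superalgebras \<open>W(m,n;t)\<close> and \<open>S(m,n;t)\<close>\<close>

text \<open>
  The vector field $\sum_{i \in Y} f_i D_i$ is represented by the family of its coefficients $f_i$,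
  which is legitimate because the $D_i$ are linearly independent over \<open>\<Lambda>\<close>.
  \<open>vf f i\<close> is $f D_i$.
\<close>

definition vf :: "(idx \<Rightarrow> 'a::field) \<Rightarrow> nat \<Rightarrow> (nat \<Rightarrow> idx \<Rightarrow> 'a)" where
  "vf f i = (\<lambda>j. if j = i then f else 0)"

definition W :: "nat \<Rightarrow> nat \<Rightarrow> nat \<Rightarrow> (nat \<Rightarrow> nat) \<Rightarrow> (nat \<Rightarrow> idx \<Rightarrow> 'a::field) set" where
  "W p m n t = {\<Sum>i\<in>Y m n. vf (f i) i | f. \<forall>i\<in>Y m n. f i \<in> Lam p m n t}"

definition W_hom ::
  "nat \<Rightarrow> nat \<Rightarrow> nat \<Rightarrow> (nat \<Rightarrow> nat) \<Rightarrow> bit \<Rightarrow> (nat \<Rightarrow> idx \<Rightarrow> 'a::field) set" where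
  "W_hom p m n t a =
     {X \<in> W p m n t. \<forall>i\<in>Y m n. X i \<in> Lam_hom p m n t (a + tau m i)}"

definition wscale :: "'a::field \<Rightarrow> (nat \<Rightarrow> idx \<Rightarrow> 'a) \<Rightarrow> (nat \<Rightarrow> idx \<Rightarrow> 'a)" where
  "wscale c X = (\<lambda>i. lscale c (X i))"

global_interpretation wvec: vector_space "wscale :: 'a::field \<Rightarrow> _"
  by unfold_locales (auto simp: wscale_def lscale_def fun_eq_iff algebra_simps)

text \<open>\<open>br_basic\<close> is $[f D_i, g D_j]$ for homogeneous \<open>f\<close> of parity \<open>a\<close> and \<open>g\<close> of parity \<open>b\<close>;
  \<open>br\<close> is its bilinear extension.\<close>

definition br_basic ::
  "nat \<Rightarrow> nat \<Rightarrow> nat \<Rightarrow> (nat \<Rightarrow> nat) \<Rightarrow> bit \<Rightarrow> (idx \<Rightarrow> 'a::field) \<Rightarrow> nat \<Rightarrow>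
   bit \<Rightarrow> (idx \<Rightarrow> 'a) \<Rightarrow> nat \<Rightarrow> (nat \<Rightarrow> idx \<Rightarrow> 'a)" where
  "br_basic p m n t a f i b g j =
     vf (lmult p m n t f (D p m n t i g)) j
     - wscale (sg ((a + tau m i) * (b + tau m j))) (vf (lmult p m n t g (D p m n t j f)) i)"

definition br ::
  "nat \<Rightarrow> nat \<Rightarrow> nat \<Rightarrow> (nat \<Rightarrow> nat) \<Rightarrow> (nat \<Rightarrow> idx \<Rightarrow> 'a::field) \<Rightarrow>
   (nat \<Rightarrow> idx \<Rightarrow> 'a) \<Rightarrow> (nat \<Rightarrow> idx \<Rightarrow> 'a)" where
  "br p m n t X Z =
     (\<Sum>i\<in>Y m n. \<Sum>j\<in>Y m n. \<Sum>a\<in>{0, 1}. \<Sum>b\<in>{0, 1}.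
        br_basic p m n t a (hpart a (X i)) i b (hpart b (Z j)) j)"

definition Dij_hom ::
  "nat \<Rightarrow> nat \<Rightarrow> nat \<Rightarrow> (nat \<Rightarrow> nat) \<Rightarrow> nat \<Rightarrow> nat \<Rightarrow> bit \<Rightarrow> (idx \<Rightarrow> 'a::field) \<Rightarrow>
   (nat \<Rightarrow> idx \<Rightarrow> 'a)" where
  "Dij_hom p m n t i j a f =
     - wscale (sg (a * (tau m i + tau m j))) (vf (D p m n t j f) i)
     + wscale (sg (tau m i * tau m j)) (vf (D p m n t i f) j)"

definition Dij ::
  "nat \<Rightarrow> nat \<Rightarrow> nat \<Rightarrow> (nat \<Rightarrow> nat) \<Rightarrow> nat \<Rightarrow> nat \<Rightarrow> (idx \<Rightarrow> 'a::field) \<Rightarrow>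
   (nat \<Rightarrow> idx \<Rightarrow> 'a)" where
  "Dij p m n t i j f = (\<Sum>a\<in>{0, 1}. Dij_hom p m n t i j a (hpart a f))"

definition S :: "nat \<Rightarrow> nat \<Rightarrow> nat \<Rightarrow> (nat \<Rightarrow> nat) \<Rightarrow> (nat \<Rightarrow> idx \<Rightarrow> 'a::field) set" where
  "S p m n t =
     wvec.span {Dij p m n t i j f | i j f. i \<in> Y m n \<and> j \<in> Y m n \<and> f \<in> Lam p m n t}"

definition S_hom ::
  "nat \<Rightarrow> nat \<Rightarrow> nat \<Rightarrow> (nat \<Rightarrow> nat) \<Rightarrow> bit \<Rightarrow> (nat \<Rightarrow> idx \<Rightarrow> 'a::field) set" where
  "S_hom p m n t a = S p m n t \<inter> W_hom p m n t a"

end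

theory Submission
  imports Defs
begin

text \<open>
  Write $H = x_{k_0} D_{k_0} + x_{k_1} D_{k_1}$ and $E = x_{k_1} D_{i_0}$. The arguments of
  $\phi$ are $H$ and $-E$, and $[H, E] = E$. Expanding $\phi([x,u],[y,v])$ first in one argument or first in the other and comparing gives
  $[\phi(x,y),[u,v]] = \pm [[x,y],\phi(u,v)]$. For $x, y, u, v$ among the fields of degree at most 0
  (the $D_k$, the $x_i D_k$ and the torus elements such as $H$) this only needs the Jacobi identity with
  two such arguments, hence only the operators $D_k$ and multiplication by $x_i$. As every $D_k$ and every
  $x_i D_k$ with $i \neq k$ is a bracket $[u,v]$ and together they have trivial centralizer, $[x,y] = 0$ implies
  $\phi(x,y) = 0$. Consequently $X = \phi(H,E)$ commutes with all $D_k$, $k \neq k_1$, so its coefficients lie in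
  the span of $1$ and $x_{k_1}$, and $X$ has the same torus weight as $E$. Three torus elements suffice to conclude
  that $X$ is a multiple of $E$.
\<close>

section \<open>Skew-symmetric biderivations\<close>

text \<open>The index k1 is the one that escapes, and this shapes the last part. For k different
  from k1 choose r outside {k, k1, i0} and write D_k = [u, v] with u = D_r and v = x_r D_k. Both u
  and v commute with E, so \<phi>(u, E) = 0, and expanding \<phi>(u, [v, E]) = 0 gives
  [\<phi>(u, v), E] = 0. Since [H, E] = E, the comparison identity turns this into [D_k, X] = 0. For
  k = k1 the field x_r D_{k1} moves E to x_r D_{i0}, and D_{k1} does not commute with E itself. What
  remains are the fields D_j and x_{k1} D_j, among which weights must single out one. Weights are
  scalars of the field and see exponents only modulo p, which is why derivatives are used before
  weights.\<close>

definition psign :: "bit \<Rightarrow> 'v::ab_group_add \<Rightarrow> 'v" where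
  "psign a v = (if a = 0 then v else - v)"

lemma psign_simps [simp]: "psign 0 v = v" "psign 1 v = - v" "psign a 0 = 0"
  by (simp_all add: psign_def)

lemma psign_psign: "psign a (psign b v) = psign (a + b) v"
  by (cases a; cases b) simp_all

lemma psign_add: "psign a (v + w) = psign a v + psign a w"
  by (simp add: psign_def)

lemma psign_minus: "psign a (- v) = - psign a v"
  by (simp add: psign_def)

lemma psign_eq_0_iff [simp]: "psign a v = 0 \<longleftrightarrow> v = 0"
  by (simp add: psign_def)

text \<open>
  \<open>K\<close> carries the homogeneous parts of the ambient superalgebra and \<open>G\<close> those of the subalgebra on which
  \<open>\<phi>\<close> lives; the Jacobi identity is only required when two arguments belong to \<open>L\<close>.
\<close>

locale skew_biderivation_on =
  fixes br \<phi> :: "'v::ab_group_add \<Rightarrow> 'v \<Rightarrow> 'v"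
    and L G K :: "bit \<Rightarrow> 'v set"
    and \<gamma> :: bit
  assumes two_torsion_free: "\<And>v::'v. v + v = 0 \<Longrightarrow> v = 0"
    and br_add_left: "\<And>x y z. br (x + y) z = br x z + br y z"
    and br_add_right: "\<And>x y z. br x (y + z) = br x y + br x z"
    and L_subset_G: "\<And>a. L a \<subseteq> G a"
    and G_subset_K: "\<And>a. G a \<subseteq> K a"
    and br_L_G: "\<And>a b x y. x \<in> L a \<Longrightarrow> y \<in> L b \<Longrightarrow> br x y \<in> G (a + b)"
    and br_L_K: "\<And>a b x w. x \<in> L a \<Longrightarrow> w \<in> K b \<Longrightarrow> br x w \<in> K (a + b)"
    and br_skew: "\<And>a b x y. x \<in> K a \<Longrightarrow> y \<in> K b \<Longrightarrow> br x y = - psign (a * b) (br y x)"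
    and jacobi: "\<And>a b c x y w. x \<in> L a \<Longrightarrow> y \<in> L b \<Longrightarrow> w \<in> K c \<Longrightarrow>
      br x (br y w) = br (br x y) w + psign (a * b) (br y (br x w))"
    and phi_G: "\<And>a b x y. x \<in> G a \<Longrightarrow> y \<in> G b \<Longrightarrow> \<phi> x y \<in> G (a + b + \<gamma>)"
    and phi_br: "\<And>a b c x y z. x \<in> G a \<Longrightarrow> y \<in> G b \<Longrightarrow> z \<in> G c \<Longrightarrow>
      \<phi> x (br y z) = br (\<phi> x y) z + psign ((\<gamma> + a) * b) (br y (\<phi> x z))"
    and phi_skew: "\<And>a b x y. x \<in> G a \<Longrightarrow> y \<in> G b \<Longrightarrow>
      \<phi> x y = - psign (\<gamma> * a + \<gamma> * b + a * b) (\<phi> y x)"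
begin

lemma br_zero [simp]: "br 0 x = 0" "br x 0 = 0"
  using br_add_left[of 0 0 x] br_add_right[of x 0 0] by simp_all

lemma br_minus [simp]: "br (- x) y = - br x y" "br x (- y) = - br x y"
  using br_add_left[of x "- x" y] br_add_right[of x y "- y"]
  by (simp_all add: eq_neg_iff_add_eq_0 add.commute)

lemma br_psign [simp]: "br (psign a x) y = psign a (br x y)" "br x (psign a y) = psign a (br x y)"
  by (simp_all add: psign_def)

lemma L_G: "x \<in> L a \<Longrightarrow> x \<in> G a"
  and G_K: "x \<in> G a \<Longrightarrow> x \<in> K a"
  and L_K: "x \<in> L a \<Longrightarrow> x \<in> K a"
  using L_subset_G G_subset_K by blast+

text \<open>Skew-symmetry carries the derivation rule of the second argument over to the first.
  Membership of \<open>br x z\<close> in \<open>G\<close> is a hypothesis here because the locale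
  grants it only for arguments from \<open>L\<close>.\<close>

lemma phi_br_left:
  assumes "x \<in> G a" "y \<in> G b" "z \<in> G c" "br x z \<in> G (a + c)"
  shows "\<phi> (br x z) y = br x (\<phi> z y) + psign ((\<gamma> + b) * c) (br (\<phi> x y) z)"
proof -
  have "\<phi> (br x z) y = - psign (\<gamma> * (a + c) + \<gamma> * b + (a + c) * b) (\<phi> y (br x z))"
    using phi_skew[OF assms(4,2)] .
  also have "\<phi> y (br x z) = br (\<phi> y x) z + psign ((\<gamma> + b) * a) (br x (\<phi> y z))"
    using phi_br[OF assms(2,1,3)] .
  also have "\<phi> y x = - psign (\<gamma> * b + \<gamma> * a + b * a) (\<phi> x y)"
    using phi_skew[OF assms(2,1)] .
  also have "\<phi> y z = - psign (\<gamma> * b + \<gamma> * c + b * c) (\<phi> z y)"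
    using phi_skew[OF assms(2,3)] .
  finally show ?thesis
    by (cases a; cases b; cases c; cases \<gamma>) (simp_all add: add.commute)
qed

text \<open>Bresar's trick: expand \<open>\<phi> [x, u] [y, v]\<close> by both derivation rules in either order.\<close>

definition defect :: "bit \<Rightarrow> bit \<Rightarrow> bit \<Rightarrow> bit \<Rightarrow> 'v \<Rightarrow> 'v \<Rightarrow> 'v \<Rightarrow> 'v \<Rightarrow> 'v" where
  "defect a b c d x y u v = psign ((\<gamma> + c) * b) (br (br x y) (\<phi> u v))
     + psign ((\<gamma> + b) * c + (\<gamma> + a + b) * (c + d)) (br (br u v) (\<phi> x y))"

text \<open>The two expansions of \<phi>([x, u], [y, v]) contain the values \<phi>(u, y), \<phi>(x,
  y), \<phi>(u, v), \<phi>(x, v). By Jacobi the terms with each value collapse to a single double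
  bracket: \<phi>(u, v) and \<phi>(x, y) make up the defect on the left, the other two the defect on
  the right.\<close>

lemma defect_swap13:
  assumes x: "x \<in> L a" and y: "y \<in> L b" and u: "u \<in> L c" and v: "v \<in> L d"
  shows "defect a b c d x y u v = psign (a * c) (defect c b a d u y x v)"
proof -
  note LG = x[THEN L_G] y[THEN L_G] u[THEN L_G] v[THEN L_G]
  have P: "br x u \<in> G (a + c)" and Q: "br y v \<in> G (b + d)"
    using br_L_G x y u v by auto
  define U where "U = \<phi> u y"
  define V where "V = \<phi> x y"
  define R where "R = \<phi> u v"
  define T where "T = \<phi> x v"
  have K: "U \<in> K (c + b + \<gamma>)" "V \<in> K (a + b + \<gamma>)" "R \<in> K (c + d + \<gamma>)" "T \<in> K (a + d + \<gamma>)"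
    unfolding U_def V_def R_def T_def by (rule G_K, rule phi_G; rule LG)+
  have W1: "\<phi> (br x u) (br y v) =
      br (br x U + psign ((\<gamma> + b) * c) (br V u)) v
      + psign ((\<gamma> + (a + c)) * b) (br y (br x R + psign ((\<gamma> + d) * c) (br T u)))"
    unfolding U_def V_def R_def T_def
    using phi_br[OF P LG(2,4)] phi_br_left[OF LG(1,2,3) P] phi_br_left[OF LG(1,4,3) P] by simp
  have W2: "\<phi> (br x u) (br y v) =
      br x (br U v + psign ((\<gamma> + c) * b) (br y R))
      + psign ((\<gamma> + (b + d)) * c) (br (br V v + psign ((\<gamma> + a) * b) (br y T)) u)"
    unfolding U_def V_def R_def T_def
    using phi_br_left[OF LG(1) Q LG(3) P] phi_br[OF LG(3,2,4)] phi_br[OF LG(1,2,4)] by simp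
  note LK = x[THEN L_K] y[THEN L_K] u[THEN L_K] v[THEN L_K]
  \<comment> \<open>\<open>jacobi\<close> needs the element of \<open>K\<close> in the innermost
    right position, so skew-symmetry first moves \<open>U\<close>, \<open>V\<close>,
    \<open>T\<close> there.\<close>
  have s: "br (br x U) v = - psign ((a + (c + b + \<gamma>)) * d) (br v (br x U))"
    "br V u = - psign ((a + b + \<gamma>) * c) (br u V)"
    "br (br u V) v = - psign ((c + (a + b + \<gamma>)) * d) (br v (br u V))"
    "br T u = - psign ((a + d + \<gamma>) * c) (br u T)"
    "br U v = - psign ((c + b + \<gamma>) * d) (br v U)"
    "br V v = - psign ((a + b + \<gamma>) * d) (br v V)"
    "br (br v V) u = - psign ((d + (a + b + \<gamma>)) * c) (br u (br v V))"
    "br (br y T) u = - psign ((b + (a + d + \<gamma>)) * c) (br u (br y T))"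
    by (intro br_skew br_L_K K LK x y u v)+
  have j: "br (br x y) R = br x (br y R) - psign (a * b) (br y (br x R))"
    "br (br u v) V = br u (br v V) - psign (c * d) (br v (br u V))"
    "br (br u y) T = br u (br y T) - psign (c * b) (br y (br u T))"
    "br (br x v) U = br x (br v U) - psign (a * d) (br v (br x U))"
    using jacobi[OF x y K(3)] jacobi[OF u v K(2)] jacobi[OF u y K(4)] jacobi[OF x v K(1)] by simp_all
  have "br (br x U + psign ((\<gamma> + b) * c) (br V u)) v
      + psign ((\<gamma> + (a + c)) * b) (br y (br x R + psign ((\<gamma> + d) * c) (br T u)))
      = br x (br U v + psign ((\<gamma> + c) * b) (br y R))
      + psign ((\<gamma> + (b + d)) * c) (br (br V v + psign ((\<gamma> + a) * b) (br y T)) u)"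
    using W1 W2 by simp
  hence *: "br (br x U) v + psign ((\<gamma> + b) * c) (br (br V u) v)
      + psign ((\<gamma> + (a + c)) * b) (br y (br x R)) + psign ((\<gamma> + (a + c)) * b + (\<gamma> + d) * c) (br y (br T u))
      - br x (br U v) - psign ((\<gamma> + c) * b) (br x (br y R))
      - psign ((\<gamma> + (b + d)) * c) (br (br V v) u)
      - psign ((\<gamma> + (b + d)) * c + (\<gamma> + a) * b) (br (br y T) u) = 0"
    by (simp add: br_add_left br_add_right psign_add psign_psign algebra_simps)
  have "defect a b c d x y u v - psign (a * c) (defect c b a d u y x v) = 
     - (br (br x U) v + psign ((\<gamma> + b) * c) (br (br V u) v)
      + psign ((\<gamma> + (a + c)) * b) (br y (br x R)) + psign ((\<gamma> + (a + c)) * b + (\<gamma> + d) * c) (br y (br T u))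
      - br x (br U v) - psign ((\<gamma> + c) * b) (br x (br y R))
      - psign ((\<gamma> + (b + d)) * c) (br (br V v) u)
      - psign ((\<gamma> + (b + d)) * c + (\<gamma> + a) * b) (br (br y T) u))"
    unfolding defect_def U_def[symmetric] V_def[symmetric] R_def[symmetric] T_def[symmetric] j
    by (simp only: s br_psign br_minus psign_minus)
       (cases a; cases b; cases c; cases d; cases \<gamma>; simp add: algebra_simps)
  thus ?thesis using * by simp
qed

text \<open>The first term changes by skew-symmetry of the bracket, the second by that of \<phi>.
  The prefactors in \<open>defect\<close> are such that both changes amount to the same
  sign.\<close>

lemma defect_swap12:
  assumes x: "x \<in> L a" and y: "y \<in> L b"
  shows "defect b a c d y x u v = - psign ((\<gamma> + c) * (a + b) + a * b) (defect a b c d x y u v)"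
proof -
  have 1: "br y x = - psign (a * b) (br x y)"
    using br_skew[OF L_K[OF y] L_K[OF x]] by (simp add: mult.commute)
  have 2: "\<phi> y x = - psign (\<gamma> * a + \<gamma> * b + a * b) (\<phi> x y)"
    using phi_skew[OF L_G[OF y] L_G[OF x]] by (simp only: ac_simps)
  show ?thesis
    unfolding defect_def 1 2
    by (cases a; cases b; cases c; cases d; cases \<gamma>; simp add: algebra_simps)
qed

text \<open>
  The transpositions (12) and (13) are conjugate, so they cannot act on the defect by opposite signs
  unless it vanishes.
\<close>

lemma defect_eq_0:
  assumes x: "x \<in> L a" and y: "y \<in> L b" and u: "u \<in> L c" and v: "v \<in> L d"
  shows "defect a b c d x y u v = 0"
proof -
  have "defect a b c d x y u v = - defect a b c d x y u v"
    \<comment> \<open>The product of (13) and (12) is a 3-cycle, so six alternating swaps restore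
      the order x, y, u, v. The parity signs cancel, and each of the three (12) swaps leaves a
      factor -1.\<close>
    apply (subst defect_swap13[OF x y u v], subst defect_swap12[OF y u],
        subst defect_swap13[OF y u x v], subst defect_swap12[OF u x],
        subst defect_swap13[OF u x y v], subst defect_swap12[OF x y])
    by (cases a; cases b; cases c; cases d; cases \<gamma>; simp)
  thus ?thesis
    using two_torsion_free by (metis add.right_inverse)
qed

text \<open>The form in which the vanishing defect is applied: with [x, y] = 0 it bounds \<phi>(x,
  y) by a centralizer, and with [x, y] = [H, E] = E it yields the derivatives that kill \<phi>(H,
  E).\<close>

lemma br_phi_br_eq_0:
  assumes "x \<in> L a" "y \<in> L b" "u \<in> L c" "v \<in> L d" "br (br x y) (\<phi> u v) = 0"
  shows "br (br u v) (\<phi> x y) = 0"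
  using defect_eq_0[OF assms(1-4)] assms(5) by (simp add: defect_def)

end

section \<open>Differentiation and multiplication by generators\<close>

lemma sum_fun_apply: "(\<Sum>i\<in>I. f i) x = (\<Sum>i\<in>I. f i x)"
  by (induction I rule: infinite_finite_induct) simp_all

lemma lscale_apply [simp]: "lscale c f b = c * f b"
  by (simp add: lscale_def)

lemma lscale_sg: "lscale (sg a) f = psign a f"
  by (simp add: fun_eq_iff sg_def psign_def)

text \<open>Links the scalar signs of the statement with conditional negation. The latter makes
  sense in any abelian group and lets a split over parities settle every sign.\<close>

lemma wscale_sg: "wscale (sg a) X = psign a X"
  by (simp add: wscale_def lscale_sg fun_eq_iff psign_def)

text \<open>The index 0, which is not in \<open>Y\<close>, stands for the constant 1: then \<open>D_k\<close> and \<open>x_i D_k\<close> are treated uniformly.\<close>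

definition gen1 :: "nat \<Rightarrow> nat \<Rightarrow> (idx \<Rightarrow> 'a::field)" where
  "gen1 m i = (if i = 0 then xmono 0 {} else gen m i)"

text \<open>\<open>tau m 0\<close> would be 1, since 0 lies outside \<open>Y0 m\<close>, whereas the
  constant 1 that index 0 stands for is even.\<close>

definition par :: "nat \<Rightarrow> nat \<Rightarrow> bit" where
  "par m i = (if i = 0 then 0 else tau m i)"

definition sign_below :: "nat \<Rightarrow> nat set \<Rightarrow> 'a::field" where
  "sign_below i u = (- 1) ^ card {j \<in> u. j < i}"

lemma sign_below_sq [simp]: "sign_below i u * sign_below i u = 1"
  by (simp add: sign_below_def flip: power_mult_distrib)

lemma sign_below_sq' [simp]: "sign_below i u * (sign_below i u * x) = x"
  by (simp flip: mult.assoc)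

lemma sign_below_insert: "finite u \<Longrightarrow> k \<notin> u \<Longrightarrow> sign_below i (insert k u) = (if k < i then - sign_below i u else sign_below i u)"
proof -
  assume "finite u" "k \<notin> u"
  moreover have "{j \<in> insert k u. j < i} = (if k < i then insert k {j \<in> u. j < i} else {j \<in> u. j < i})"
    by auto
  ultimately show ?thesis by (simp add: sign_below_def)
qed

lemma sign_below_remove:
  assumes "finite u" "k \<in> u"
  shows "sign_below i (u - {k}) = (if k < i then - sign_below i u else sign_below i u)"
proof -
  have "sign_below i u = (if k < i then - sign_below i (u - {k}) else sign_below i (u - {k}) :: 'a)"
    using sign_below_insert[of "u - {k}" k i] assms by (simp add: insert_absorb)
  thus ?thesis by simp
qed

lemma sign_below_self [simp]: "sign_below i (u - {i}) = sign_below i u" "sign_below i (insert i u) = sign_below i u"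
  unfolding sign_below_def by (rule arg_cong[where f = "\<lambda>S. (- 1) ^ card S"], auto)+

locale special_superalgebra =
  fixes p m n :: nat and t :: "nat \<Rightarrow> nat" and F :: "'a::field itself"
  assumes char: "CHAR('a) = p" and p: "p > 2" and m: "m \<ge> 2" and n: "n \<ge> 2" and t: "\<forall>i\<in>Y0 m. t i > 0"
begin

abbreviation "Dv \<equiv> D p m n t :: nat \<Rightarrow> (idx \<Rightarrow> 'a) \<Rightarrow> _"
abbreviation "M i \<equiv> lmult p m n t (gen1 m i) :: (idx \<Rightarrow> 'a) \<Rightarrow> _"
abbreviation "\<Lambda> \<equiv> Lam p m n t :: (idx \<Rightarrow> 'a) set"
abbreviation "BB \<equiv> basis p m n t"
abbreviation "YY \<equiv> Y m n"
abbreviation "Y' \<equiv> insert 0 YY"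

lemma Y_simps: "i \<in> YY \<longleftrightarrow> 1 \<le> i \<and> i \<le> m + n" "i \<in> Y0 m \<longleftrightarrow> 1 \<le> i \<and> i \<le> m"
  "i \<in> Y1 m n \<longleftrightarrow> m < i \<and> i \<le> m + n"
  by (auto simp: Y_def Y0_def Y1_def)

lemma finite_Y [simp]: "finite YY" "finite (Y0 m)"
  by (auto simp: Y_def Y0_def Y1_def)

lemma Y_cases:
  assumes "i \<in> YY" obtains "i \<in> Y0 m" "par m i = 0" | "i \<notin> Y0 m" "i \<in> Y1 m n" "par m i = 1"
  using assms by (auto simp: Y_def par_def tau_def Y0_def Y1_def)

lemma finite_A: "finite (A p m t)"
proof -
  let ?N = "\<Sum>i\<in>Y0 m. p ^ t i"
  have "\<alpha> i \<le> ?N" if "\<alpha> \<in> A p m t" "i \<in> Y0 m" for \<alpha> i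
  proof -
    have "\<alpha> i \<le> p ^ t i" using that by (force simp: A_def)
    also have "\<dots> \<le> ?N" by (rule member_le_sum) (use that in auto)
    finally show ?thesis .
  qed
  hence "A p m t \<subseteq> {\<alpha>. \<forall>i. (i \<in> Y0 m \<longrightarrow> \<alpha> i \<in> {..?N}) \<and> (i \<notin> Y0 m \<longrightarrow> \<alpha> i = 0)}"
    by (auto simp: A_def)
  thus ?thesis
    by (rule finite_subset) (rule finite_set_of_finite_funs; simp)
qed

lemma finite_basis [simp]: "finite BB"
  using finite_A by (auto simp: basis_def B_def Y1_def)

lemma Lam_0: "f \<in> \<Lambda> \<Longrightarrow> b \<notin> BB \<Longrightarrow> f b = 0"
  unfolding Lam_def by blast

lemma zero_A: "0 \<in> A p m t"
  by (simp add: A_def)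

lemma eps_A: "i \<in> Y0 m \<Longrightarrow> eps i \<in> A p m t"
  using t p one_less_power[of p "t i"] by (auto simp: A_def eps_def)

lemma A_down: "\<alpha> + \<beta> \<in> A p m t \<Longrightarrow> \<beta> \<in> A p m t"
  by (auto simp: A_def intro: le_trans[rotated])

text \<open>For the operators treated here at most one basis element \<open>b0\<close> contributes
  to the coefficient at \<open>c\<close>. The candidate \<open>b0\<close> may lie outside the basis,
  and then \<open>f b0 = 0\<close> keeps the formula valid; this absorbs the truncation of the
  exponents.\<close>

lemma sum_delta_apply:
  "(\<Sum>b\<in>BB. lscale (f b) (H b)) c = f b0 * H b0 c"
  if "f \<in> \<Lambda>" "\<And>b. b \<in> BB \<Longrightarrow> b \<noteq> b0 \<Longrightarrow> H b c = 0"
proof -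
  have "(\<Sum>b\<in>BB. lscale (f b) (H b)) c = (\<Sum>b\<in>BB. if b = b0 then f b0 * H b0 c else 0)"
    unfolding sum_fun_apply using that(2) by (intro sum.cong) simp_all
  also have "\<dots> = f b0 * H b0 c"
    using Lam_0[OF that(1), of b0] by (simp add: sum.delta)
  finally show ?thesis .
qed

text \<open>In terms of coefficients the derivative is a shift of the multi-index. Beyond the
  truncation the shifted coefficient is zero because \<open>f\<close> lies in \<open>Lam\<close>.
  Such formulas turn operator identities into arithmetic of indices.\<close>

lemma D_even:
  assumes "f \<in> \<Lambda>" "i \<in> Y0 m"
  shows "Dv i f (\<alpha>, u) = f (\<alpha> + eps i, u)"
proof -
  have "Dv i f (\<alpha>, u) = f (\<alpha> + eps i, u) * D_mono m i (\<alpha> + eps i, u) (\<alpha>, u)"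
    unfolding D_def
    by (rule sum_delta_apply[OF assms(1)])
       (auto simp: D_mono_def assms xmono_def fun_eq_iff eps_def split: if_splits)
  thus ?thesis by (auto simp: D_mono_def assms xmono_def eps_def fun_eq_iff)
qed

lemma D_odd:
  assumes "f \<in> \<Lambda>" "i \<notin> Y0 m"
  shows "Dv i f (\<alpha>, u) = (if i \<in> u then 0 else sign_below i u * f (\<alpha>, insert i u))"
proof -
  have "Dv i f (\<alpha>, u) = f (\<alpha>, insert i u) * D_mono m i (\<alpha>, insert i u) (\<alpha>, u)"
    unfolding D_def
    by (rule sum_delta_apply[OF assms(1)])
       (auto simp: D_mono_def assms xmono_def split: if_splits)
  moreover have "{j \<in> insert i u. j < i} = {j \<in> u. j < i}" by auto
  ultimately show ?thesis
    by (auto simp: D_mono_def assms xmono_def sign_below_def)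
qed

lemma gen1_Lam: "i \<in> Y' \<Longrightarrow> gen1 m i \<in> \<Lambda>"
  using zero_A eps_A
  by (auto simp: Lam_def gen1_def gen_def xmono_def basis_def B_def Y_def)

definition gidx :: "nat \<Rightarrow> idx" where
  "gidx i = (if i = 0 then (0, {}) else if i \<in> Y0 m then (eps i, {}) else (0, {i}))"

lemma gen1_gidx: "gen1 m i b = (if b = gidx i then 1 else 0)"
  by (simp add: gen1_def gen_def gidx_def xmono_def)

lemma gidx_basis: "i \<in> Y' \<Longrightarrow> gidx i \<in> BB"
  using zero_A eps_A by (auto simp: gidx_def basis_def B_def Y_def)

lemma M_eq: "i \<in> Y' \<Longrightarrow> M i f = (\<Sum>c\<in>BB. lscale (f c) (mono_mult p m t (gidx i) c))"
  unfolding lmult_def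
  by (subst sum.remove[OF finite_basis gidx_basis])
     (auto simp: gen1_gidx lscale_def fun_eq_iff sum_fun_apply intro!: sum.neutral sum.cong)

lemma M_one: "f \<in> \<Lambda> \<Longrightarrow> M 0 f = f"
proof (intro ext)
  fix b assume f: "f \<in> \<Lambda>"
  have *: "0 \<in> Y'" by simp
  have "M 0 f b = f b * mono_mult p m t (gidx 0) b b"
    unfolding M_eq[OF *]
    by (rule sum_delta_apply[OF f]) (auto simp: gidx_def mono_mult_def xmono_def split: prod.splits)
  thus "M 0 f b = f b"
    using Lam_0[OF f, of b] Lam_0[OF f]
    by (cases b) (auto simp: gidx_def mono_mult_def xmono_def basis_def B_def fun_eq_iff)
qed

lemma prod_choose_eps:
  "i \<in> Y0 m \<Longrightarrow> (\<Prod>j\<in>Y0 m. (eps i j + \<beta> j) choose eps i j) = Suc (\<beta> i)"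
proof -
  assume i: "i \<in> Y0 m"
  have "(\<Prod>j\<in>Y0 m. (eps i j + \<beta> j) choose eps i j) = (\<Prod>j\<in>Y0 m. if j = i then Suc (\<beta> i) else 1)"
    by (rule prod.cong) (auto simp: eps_def)
  thus ?thesis using i by simp
qed

text \<open>At the truncation boundary \<open>\<alpha> i = p ^ t i\<close> the coefficient vanishes by itself.\<close>

lemma M_even:
  assumes f: "f \<in> \<Lambda>" and i: "i \<in> Y0 m"
  shows "M i f (\<alpha>, u) = of_nat (\<alpha> i) * f (\<alpha> - eps i, u)"
proof -
  have iY: "i \<in> Y'" using i by (simp add: Y_def)
  have i0: "i \<noteq> 0" using i by (simp add: Y0_def)
  have *: "M i f (\<alpha>, u) = f (\<alpha> - eps i, u) * mono_mult p m t (gidx i) (\<alpha> - eps i, u) (\<alpha>, u)"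
    unfolding M_eq[OF iY]
    by (rule sum_delta_apply[OF f])
       (auto simp: gidx_def mono_mult_def xmono_def i i0 fun_eq_iff split: if_splits)
  show ?thesis
  proof (cases "\<alpha> i = 0")
    case True
    hence "eps i + (\<alpha> - eps i) \<noteq> \<alpha>" by (auto simp: fun_eq_iff eps_def)
    thus ?thesis unfolding * using i i0 True by (auto simp: gidx_def mono_mult_def xmono_def)
  next
    case False
    hence e: "eps i + (\<alpha> - eps i) = \<alpha>" by (auto simp: fun_eq_iff eps_def)
    have s: "Suc ((\<alpha> - eps i) i) = \<alpha> i" using False by (simp add: eps_def)
    show ?thesis
    proof (cases "\<alpha> \<in> A p m t")
      case True
      have "(\<Prod>j\<in>Y0 m. (eps i j + (\<alpha> j - eps i j)) choose eps i j) = \<alpha> i"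
        using prod_choose_eps[OF i, of "\<alpha> - eps i"] s by simp
      thus ?thesis unfolding * using i i0 e True by (auto simp: gidx_def mono_mult_def xmono_def)
    next
      case nA: False
      have "of_nat (\<alpha> i) * f (\<alpha> - eps i, u) = 0"
      proof (cases "(\<alpha> - eps i, u) \<in> BB")
        case True
        hence a: "\<alpha> - eps i \<in> A p m t" by (simp add: basis_def)
        have "\<alpha> i = p ^ t i"
        proof (rule ccontr)
          assume ne: "\<alpha> i \<noteq> p ^ t i"
          have "\<alpha> j \<le> p ^ t j - 1" if "j \<in> Y0 m" for j
          proof -
            have "\<alpha> j - eps i j \<le> p ^ t j - 1" using a that by (simp add: A_def)
            moreover obtain P where "p ^ t j = Suc P" using p by (cases "p ^ t j") auto
            ultimately show ?thesis using ne by (cases "j = i") (auto simp: eps_def)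
          qed
          moreover have "\<alpha> j = 0" if "j \<notin> Y0 m" for j
            using a that i by (cases "j = i") (force simp: A_def eps_def)+
          ultimately show False using nA by (auto simp: A_def)
        qed
        moreover have "CHAR('a) dvd p ^ t i"
          using char t i by (simp add: dvd_power)
        ultimately show ?thesis by (simp add: of_nat_eq_0_iff_char_dvd del: of_nat_power)
      qed (simp add: Lam_0[OF f])
      thus ?thesis unfolding * using i i0 e nA by (auto simp: gidx_def mono_mult_def)
    qed
  qed
qed

lemma M_odd:
  assumes f: "f \<in> \<Lambda>" and i: "i \<in> Y1 m n"
  shows "M i f (\<alpha>, u) = (if i \<in> u then sign_below i u * f (\<alpha>, u - {i}) else 0)"
proof -
  have iY: "i \<in> Y'" using i by (simp add: Y_def)
  have i0: "i \<noteq> 0" "i \<notin> Y0 m" using i by (auto simp: Y0_def Y1_def)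
  have *: "M i f (\<alpha>, u) = f (\<alpha>, u - {i}) * mono_mult p m t (gidx i) (\<alpha>, u - {i}) (\<alpha>, u)"
    unfolding M_eq[OF iY]
    by (rule sum_delta_apply[OF f])
       (auto simp: gidx_def mono_mult_def xmono_def i i0 fun_eq_iff split: if_splits)
  have "{(k, j). k = i \<and> (j \<in> u \<and> j \<noteq> i) \<and> j < k} = Pair i ` {j \<in> u. j < i}"
    by auto
  hence "card {(k, j). k = i \<and> (j \<in> u \<and> j \<noteq> i) \<and> j < k} = card {j \<in> u. j < i}"
    by (simp add: card_image inj_on_def)
  thus ?thesis unfolding *
    using Lam_0[OF f, of "(\<alpha>, u - {i})"] i
    by (auto simp: gidx_def mono_mult_def xmono_def sign_below_def i0 basis_def B_def insert_absorb)
qed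

end

lemma D_add: "D p m n t i (f + g) = D p m n t i f + D p m n t i g"
  by (simp add: D_def fun_eq_iff sum_fun_apply sum.distrib algebra_simps)

lemma D_0 [simp]: "D p m n t i 0 = 0"
  by (simp add: D_def fun_eq_iff sum_fun_apply)

lemma D_minus: "D p m n t i (- f) = - D p m n t i f"
  by (simp add: D_def fun_eq_iff sum_fun_apply sum_negf)

lemma lmult_add_right: "lmult p m n t f (g + h) = lmult p m n t f g + lmult p m n t f h"
  and lmult_add_left: "lmult p m n t (g + h) f = lmult p m n t g f + lmult p m n t h f"
  by (simp_all add: lmult_def fun_eq_iff sum_fun_apply sum.distrib algebra_simps)

lemma lmult_0 [simp]: "lmult p m n t f 0 = 0" "lmult p m n t 0 f = 0"
  by (simp_all add: lmult_def fun_eq_iff sum_fun_apply)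

lemma lmult_minus: "lmult p m n t f (- g) = - lmult p m n t f g"
  "lmult p m n t (- f) g = - lmult p m n t f g"
  by (simp_all add: lmult_def fun_eq_iff sum_fun_apply sum_negf)

lemma D_psign: "D p m n t i (psign a f) = psign a (D p m n t i f)"
  and lmult_psign: "lmult p m n t f (psign a g) = psign a (lmult p m n t f g)"
    "lmult p m n t (psign a f) g = psign a (lmult p m n t f g)"
  by (simp_all add: psign_def D_minus lmult_minus)

lemma D_diff: "D p m n t i (f - g) = D p m n t i f - D p m n t i g"
  and lmult_diff: "lmult p m n t h (f - g) = lmult p m n t h f - lmult p m n t h g"
  using D_add[of p m n t i f "- g"] lmult_add_right[of p m n t h f "- g"]
  by (simp_all add: D_minus lmult_minus)

lemma psign_apply: "psign a f x = psign a (f x)"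
  by (simp add: psign_def)

context special_superalgebra
begin

lemma zero_Lam [simp]: "0 \<in> \<Lambda>"
  by (simp add: Lam_def)

lemma add_Lam: "f \<in> \<Lambda> \<Longrightarrow> g \<in> \<Lambda> \<Longrightarrow> f + g \<in> \<Lambda>"
  and minus_Lam: "f \<in> \<Lambda> \<Longrightarrow> - f \<in> \<Lambda>"
  and diff_Lam: "f \<in> \<Lambda> \<Longrightarrow> g \<in> \<Lambda> \<Longrightarrow> f - g \<in> \<Lambda>"
  by (simp_all add: Lam_def)

lemma lmult_Lam: "lmult p m n t f g \<in> \<Lambda>" for f g :: "idx \<Rightarrow> 'a"
proof -
  have "mono_mult p m t b c d = (0::'a)" if "b \<in> BB" "c \<in> BB" "d \<notin> BB" for b c d
    using that by (auto simp: mono_mult_def basis_def B_def xmono_def split: prod.splits)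
  thus ?thesis by (simp add: Lam_def lmult_def sum_fun_apply)
qed

lemma D_Lam: "f \<in> \<Lambda> \<Longrightarrow> Dv i f \<in> \<Lambda>"
proof -
  assume f: "f \<in> \<Lambda>"
  have "Dv i f (\<alpha>, u) = 0" if "(\<alpha>, u) \<notin> BB" for \<alpha> u
  proof (cases "i \<in> Y0 m")
    case True
    have "(\<alpha> + eps i, u) \<notin> BB" using that A_down[of "eps i" \<alpha>] by (auto simp: basis_def add.commute)
    thus ?thesis using f True by (simp add: D_even Lam_0)
  next
    case False
    have "(\<alpha>, insert i u) \<notin> BB" using that by (auto simp: basis_def B_def)
    thus ?thesis using f False by (simp add: D_odd Lam_0)
  qed
  thus ?thesis by (auto simp: Lam_def)
qed

lemma Lam_infinite: "f \<in> \<Lambda> \<Longrightarrow> infinite u \<Longrightarrow> f (\<alpha>, u) = 0"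
  by (rule Lam_0) (auto simp: basis_def B_def Y1_def dest: finite_subset)

text \<open>The index type also contains infinite sets \<open>u\<close>, for which the rules of
  \<open>sign_below\<close> fail. Elements of \<open>Lam\<close> vanish there, so comparing at
  finite \<open>u\<close> is enough.\<close>

lemma Lam_eqI:
  assumes "f \<in> \<Lambda>" "g \<in> \<Lambda>" "\<And>\<alpha> u. finite u \<Longrightarrow> f (\<alpha>, u) = g (\<alpha>, u)"
  shows "f = g"
proof
  fix b show "f b = g b"
    using assms Lam_infinite[OF assms(1)] Lam_infinite[OF assms(2)]
    by (cases b; cases "finite (snd b)") auto
qed

text \<open>The Leibniz rule for a generator times \<open>f\<close>, equivalently the canonical
  (super)commutation relations of Weyl and Clifford type, checked coefficient by coefficient.
  Together with \<open>D_D\<close> and \<open>M_M\<close> these relations carry the Jacobi identity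
  for the fields x_i D_k.\<close>

lemma D_M:
  assumes i: "i \<in> Y'" and k: "k \<in> YY" and f: "f \<in> \<Lambda>"
  shows "Dv k (M i f) = (if k = i then f else 0) + psign (par m k * par m i) (M i (Dv k f))"
proof (rule Lam_eqI)
  show "Dv k (M i f) \<in> \<Lambda>"
    "(if k = i then f else 0) + psign (par m k * par m i) (M i (Dv k f)) \<in> \<Lambda>"
    using f by (auto intro!: D_Lam lmult_Lam add_Lam minus_Lam diff_Lam)
  fix \<alpha> and u :: "nat set" assume u: "finite u"
  show "Dv k (M i f) (\<alpha>, u) = ((if k = i then f else 0) + psign (par m k * par m i) (M i (Dv k f))) (\<alpha>, u)"
  proof (cases "i = 0")
    case True
    thus ?thesis using k f by (auto simp: M_one D_Lam par_def Y_simps)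
  next
    case False
    hence i: "i \<in> YY" using i by simp
    note F = f lmult_Lam[of _ f] D_Lam[OF f]
    show ?thesis
      using i
    proof (cases rule: Y_cases)
      case 1
      from k show ?thesis
      proof (cases rule: Y_cases)
        case k1: 1
        show ?thesis
        proof (cases "k = i")
          case True
          have "\<alpha> + eps i - eps i = \<alpha>" by simp
          moreover have "\<alpha> i \<noteq> 0 \<Longrightarrow> \<alpha> - eps i + eps i = \<alpha>" by (auto simp: fun_eq_iff eps_def)
          ultimately show ?thesis using 1 k1 F True
            by (cases "\<alpha> i = 0") (simp_all add: D_even M_even psign_apply eps_def algebra_simps)
        next
          case False
          have "\<alpha> + eps k - eps i = \<alpha> - eps i + eps k" using False by (auto simp: fun_eq_iff eps_def)
          thus ?thesis using 1 k1 F False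
            by (simp add: D_even M_even psign_apply) (simp add: eps_def)
        qed
      next
        case 2
        thus ?thesis using 1 F by (auto simp: D_odd M_even psign_apply)
      qed
    next
      case 2
      from k show ?thesis
      proof (cases rule: Y_cases)
        case 1
        thus ?thesis using 2 F by (auto simp: D_even M_odd psign_apply)
      next
        case k2: 2
        have "k \<noteq> i \<Longrightarrow> insert k u - {i} = insert k (u - {i})" by auto
        thus ?thesis using 2 k2 F u
          by (auto simp: D_odd M_odd psign_apply sign_below_insert sign_below_remove insert_absorb)
      qed
    qed
  qed
qed

lemma D_D:
  assumes i: "i \<in> YY" and k: "k \<in> YY" and f: "f \<in> \<Lambda>"
  shows "Dv k (Dv i f) = psign (par m k * par m i) (Dv i (Dv k f))"
proof (rule Lam_eqI)
  show "Dv k (Dv i f) \<in> \<Lambda>" "psign (par m k * par m i) (Dv i (Dv k f)) \<in> \<Lambda>"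
    using f by (auto intro!: D_Lam minus_Lam)
  fix \<alpha> and u :: "nat set" assume u: "finite u"
  note F = f D_Lam[OF f]
  from i show "Dv k (Dv i f) (\<alpha>, u) = psign (par m k * par m i) (Dv i (Dv k f)) (\<alpha>, u)"
  proof (cases rule: Y_cases)
    case 1
    from k show ?thesis
      by (cases rule: Y_cases) (use 1 F in \<open>simp_all add: D_even D_odd psign_apply ac_simps\<close>)
  next
    case 2
    from k show ?thesis
      by (cases rule: Y_cases)
         (use 2 F u in \<open>auto simp: D_even D_odd psign_apply sign_below_insert insert_commute\<close>)
  qed
qed

lemma M_M:
  assumes i: "i \<in> Y'" and k: "k \<in> Y'" and f: "f \<in> \<Lambda>"
  shows "M k (M i f) = psign (par m k * par m i) (M i (M k f))"
proof (cases "i = 0 \<or> k = 0")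
  case True
  thus ?thesis using f by (auto simp: M_one lmult_Lam par_def)
next
  case False
  hence i: "i \<in> YY" and k: "k \<in> YY" using i k by auto
  show ?thesis
  proof (rule Lam_eqI)
    show "M k (M i f) \<in> \<Lambda>" "psign (par m k * par m i) (M i (M k f)) \<in> \<Lambda>"
      using f by (auto intro!: lmult_Lam minus_Lam)
    fix \<alpha> and u :: "nat set" assume u: "finite u"
    note F = f lmult_Lam[of _ f]
    from i show "M k (M i f) (\<alpha>, u) = psign (par m k * par m i) (M i (M k f)) (\<alpha>, u)"
    proof (cases rule: Y_cases)
      case 1
      from k show ?thesis
      proof (cases rule: Y_cases)
        case k1: 1
        have "\<alpha> - eps k - eps i = \<alpha> - eps i - eps k" by (auto simp: fun_eq_iff)
        thus ?thesis using 1 k1 F by (cases "i = k") (auto simp: M_even psign_apply eps_def)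
      qed (use 1 F in \<open>auto simp: M_even M_odd psign_apply\<close>)
    next
      case 2
      from k show ?thesis
      proof (cases rule: Y_cases)
        case k2: 2
        have "u - {k} - {i} = u - {i} - {k}" by auto
        thus ?thesis using 2 k2 F u
          by (cases "i = k") (auto simp: M_odd psign_apply sign_below_remove)
      qed (use 2 F in \<open>auto simp: M_even M_odd psign_apply\<close>)
    qed
  qed
qed

lemma D_gen1: "k \<in> YY \<Longrightarrow> i \<in> Y' \<Longrightarrow> Dv k (gen1 m i) = (if k = i then gen1 m 0 else 0)"
proof -
  assume k: "k \<in> YY" and i: "i \<in> Y'"
  have "Dv k (gen1 m i) b = (if k = i then gen1 m 0 b else 0)" for b
  proof (cases b)
    case (Pair \<alpha> u)
    have k0: "k \<noteq> 0" using k by (auto simp: Y_simps)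
    have "\<alpha> + eps k = eps i \<longleftrightarrow> k = i \<and> \<alpha> = 0" "\<alpha> + eps k \<noteq> 0"
      by (auto simp: fun_eq_iff eps_def split: if_splits)
    thus ?thesis using k0 gen1_Lam[OF i]
      by (cases "k \<in> Y0 m") (auto simp: Pair D_even D_odd gen1_gidx gidx_def sign_below_def)
  qed
  thus ?thesis by auto
qed

lemma lmult_one: "f \<in> \<Lambda> \<Longrightarrow> lmult p m n t f (gen1 m 0) = f"
proof (intro ext)
  fix b assume f: "f \<in> \<Lambda>"
  have "lmult p m n t f (gen1 m 0) = (\<Sum>b\<in>BB. \<Sum>c\<in>BB. if c = gidx 0 then lscale (f b) (mono_mult p m t b c) else 0)"
    unfolding lmult_def by (intro sum.cong) (auto simp: gen1_gidx lscale_def fun_eq_iff)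
  also have "\<dots> = (\<Sum>b\<in>BB. lscale (f b) (mono_mult p m t b (gidx 0)))"
    by (simp add: gidx_basis)
  finally have *: "lmult p m n t f (gen1 m 0) = (\<Sum>b\<in>BB. lscale (f b) (mono_mult p m t b (gidx 0)))" .
  have "lmult p m n t f (gen1 m 0) b = f b * mono_mult p m t b (gidx 0) b"
    unfolding *
    by (rule sum_delta_apply[OF f]) (auto simp: gidx_def mono_mult_def xmono_def split: prod.splits)
  thus "lmult p m n t f (gen1 m 0) b = f b"
    using Lam_0[OF f, of b] Lam_0[OF f]
    by (cases b) (auto simp: gidx_def mono_mult_def xmono_def basis_def B_def fun_eq_iff)
qed

end

section \<open>Brackets with fields of degree at most zero\<close>

lemma hpart_add: "hpart a (f + g) = hpart a f + hpart a g"
  by (simp add: hpart_def fun_eq_iff)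

lemma vf_add: "vf (f + g) i = vf f i + vf g i"
  by (simp add: vf_def fun_eq_iff)

lemma vf_0 [simp]: "vf 0 i = 0"
  by (simp add: vf_def fun_eq_iff)

lemma hpart_0 [simp]: "hpart a 0 = 0"
  by (simp add: hpart_def fun_eq_iff)

lemma br_basic_add:
  "br_basic p m n t a (f + f') i b g j = br_basic p m n t a f i b g j + br_basic p m n t a f' i b g j"
  "br_basic p m n t a f i b (g + g') j = br_basic p m n t a f i b g j + br_basic p m n t a f i b g' j"
  by (simp_all add: br_basic_def D_add lmult_add_left lmult_add_right vf_add wvec.scale_right_distrib)

lemma br_basic_0 [simp]: "br_basic p m n t a 0 i b g j = 0" "br_basic p m n t a f i b 0 j = 0"
  by (simp_all add: br_basic_def)

lemma br_add_left: "br p m n t (X + X') Z = br p m n t X Z + br p m n t X' Z"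
  and br_add_right: "br p m n t X (Z + Z') = br p m n t X Z + br p m n t X Z'"
  by (simp_all add: br_def hpart_add br_basic_add sum.distrib)

text \<open>The comparison of terms in the Jacobi identity for \<open>x_i D_k\<close> and \<open>x_l D_q\<close>, with atoms in place of the terms so that
  the split over all signs stays cheap.\<close>

lemma sign_identity:
  fixes P T T' U V w w' :: "'v::ab_group_add" and i k l q c :: bit
  assumes "kl \<Longrightarrow> k = l" "qi \<Longrightarrow> q = i"
  shows "(if kl then T else 0) + psign (k * l) P - (if jq then psign ((l + q) * c) U else 0)
      - (if jk then psign ((i + k) * (l + q + c)) (V - (if qi then psign ((l + q) * c) w else 0)) else 0)
    = (if kl then T - (if jq then psign ((i + q) * c) w' else 0) else 0)
      - psign ((i + k) * (l + q)) (if qi then T' - (if jk then psign ((l + k) * c) w else 0) else 0)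
      + psign ((i + k) * (l + q)) ((if qi then T' else 0) + psign (q * i + (q * k + l * i)) P
        - (if jk then psign ((i + k) * c) V else 0)
        - (if jq then psign ((l + q) * (i + k + c)) (U - (if kl then psign ((i + k) * c) w' else 0)) else 0))"
  using assms
  by (cases i; cases k; cases l; cases q; cases c; cases kl; cases qi; cases jk; cases jq; simp)

context special_superalgebra
begin

abbreviation "\<Lambda>h \<equiv> Lam_hom p m n t :: bit \<Rightarrow> (idx \<Rightarrow> 'a) set"
abbreviation "Wh \<equiv> W_hom p m n t :: bit \<Rightarrow> (nat \<Rightarrow> idx \<Rightarrow> 'a) set"
abbreviation "Sh \<equiv> S_hom p m n t :: bit \<Rightarrow> (nat \<Rightarrow> idx \<Rightarrow> 'a) set"
abbreviation "SS \<equiv> S p m n t :: (nat \<Rightarrow> idx \<Rightarrow> 'a) set"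
abbreviation "bra \<equiv> br p m n t :: (nat \<Rightarrow> idx \<Rightarrow> 'a) \<Rightarrow> _"

lemma sum_vf: "finite I \<Longrightarrow> (\<Sum>i\<in>I. vf (f i) i) = (\<lambda>j. if j \<in> I then f j else 0)"
  by (simp add: fun_eq_iff sum_fun_apply vf_def if_distrib[of "\<lambda>h. h _"] sum.delta cong: if_cong)

lemma vf_sum: "(\<Sum>i\<in>I. vf (f i) j) = vf (\<Sum>i\<in>I. f i) j"
  by (induction I rule: infinite_finite_induct) (simp_all only: sum.infinite sum.empty sum.insert vf_0 vf_add not_False_eq_True)

lemma W_iff: "X \<in> W p m n t \<longleftrightarrow> (\<forall>i\<in>YY. X i \<in> \<Lambda>) \<and> (\<forall>i. i \<notin> YY \<longrightarrow> X i = 0)"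
proof
  assume "X \<in> W p m n t"
  then obtain f where "X = (\<lambda>j. if j \<in> YY then f j else 0)" "\<forall>i\<in>YY. f i \<in> \<Lambda>"
    by (auto simp: W_def sum_vf)
  thus "(\<forall>i\<in>YY. X i \<in> \<Lambda>) \<and> (\<forall>i. i \<notin> YY \<longrightarrow> X i = 0)" by simp
next
  assume *: "(\<forall>i\<in>YY. X i \<in> \<Lambda>) \<and> (\<forall>i. i \<notin> YY \<longrightarrow> X i = 0)"
  hence "X = (\<Sum>i\<in>YY. vf (X i) i)" by (auto simp: sum_vf)
  thus "X \<in> W p m n t" using * unfolding W_def by blast
qed

lemma tau_par: "i \<in> YY \<Longrightarrow> tau m i = par m i"
  by (auto simp: par_def Y_simps)

lemma W_hom_iff:
  "X \<in> Wh a \<longleftrightarrow> (\<forall>i\<in>YY. X i \<in> \<Lambda>h (a + par m i)) \<and> (\<forall>i. i \<notin> YY \<longrightarrow> X i = 0)"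
  unfolding W_hom_def mem_Collect_eq W_iff by (auto simp: tau_par Lam_hom_def)

lemma Lam_hom_Lam: "f \<in> \<Lambda>h a \<Longrightarrow> f \<in> \<Lambda>"
  by (simp add: Lam_hom_def)

lemma Lam_hom_closed:
  "0 \<in> \<Lambda>h a" "f \<in> \<Lambda>h a \<Longrightarrow> g \<in> \<Lambda>h a \<Longrightarrow> f + g \<in> \<Lambda>h a" "f \<in> \<Lambda>h a \<Longrightarrow> - f \<in> \<Lambda>h a"
  by (auto simp: Lam_hom_def add_Lam minus_Lam) (metis add_0 plus_fun_apply)+

lemma W_hom_closed:
  "0 \<in> Wh a" "X \<in> Wh a \<Longrightarrow> Z \<in> Wh a \<Longrightarrow> X + Z \<in> Wh a" "X \<in> Wh a \<Longrightarrow> - X \<in> Wh a"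
  by (auto simp: W_hom_iff Lam_hom_closed)

lemma W_hom_Lam: "X \<in> Wh a \<Longrightarrow> X i \<in> \<Lambda>"
  by (cases "i \<in> YY") (auto simp: W_hom_iff Lam_hom_def)

lemma W_hom_0: "X \<in> Wh a \<Longrightarrow> X 0 = 0"
  by (auto simp: W_hom_iff Y_simps)

lemma hpart_hom: "f \<in> \<Lambda>h a \<Longrightarrow> hpart b f = (if b = a then f else 0)"
  by (auto simp: Lam_hom_def hpart_def fun_eq_iff)

lemma D_hom: "f \<in> \<Lambda>h a \<Longrightarrow> k \<in> YY \<Longrightarrow> Dv k f \<in> \<Lambda>h (a + par m k)"
proof -
  assume f: "f \<in> \<Lambda>h a" and k: "k \<in> YY"
  note F = Lam_hom_Lam[OF f]
  have "idx_parity (\<alpha>, u) = a + par m k" if *: "Dv k f (\<alpha>, u) \<noteq> 0" for \<alpha> u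
  proof -
    have u: "finite u" using Lam_infinite[OF D_Lam[OF F]] * by blast
    from k show ?thesis
    proof (cases rule: Y_cases)
      case 1
      hence "idx_parity (\<alpha> + eps k, u) = a" using f F * by (auto simp: D_even Lam_hom_def)
      thus ?thesis using 1 by (simp add: idx_parity_def)
    next
      case 2
      hence "idx_parity (\<alpha>, insert k u) = a" "k \<notin> u"
        using f F * by (auto simp: D_odd Lam_hom_def split: if_splits)
      hence "of_nat (card u) + 1 = a" using u by (simp add: idx_parity_def)
      thus ?thesis using 2 by (cases "of_nat (card u) :: bit") (auto simp: idx_parity_def)
    qed
  qed
  thus ?thesis using D_Lam[OF F] by (auto simp: Lam_hom_def simp del: bit_not_one_iff bit_not_zero_iff)
qed

lemma M_hom: "f \<in> \<Lambda>h a \<Longrightarrow> k \<in> Y' \<Longrightarrow> M k f \<in> \<Lambda>h (par m k + a)"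
proof -
  assume f: "f \<in> \<Lambda>h a" and k: "k \<in> Y'"
  note F = Lam_hom_Lam[OF f]
  show ?thesis
  proof (cases "k = 0")
    case True thus ?thesis using f F by (cases a) (simp_all add: M_one par_def)
  next
    case False
    hence k: "k \<in> YY" using k by simp
    have "idx_parity (\<alpha>, u) = par m k + a" if *: "M k f (\<alpha>, u) \<noteq> 0" for \<alpha> u
    proof -
      have u: "finite u" using Lam_infinite[OF lmult_Lam] * by blast
      from k show ?thesis
      proof (cases rule: Y_cases)
        case 1
        hence "idx_parity (\<alpha> - eps k, u) = a" using f F * by (auto simp: M_even Lam_hom_def)
        thus ?thesis using 1 by (simp add: idx_parity_def)
      next
        case 2
        hence "idx_parity (\<alpha>, u - {k}) = a" "k \<in> u"
          using f F * by (auto simp: M_odd Lam_hom_def split: if_splits)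
        moreover have "idx_parity (\<alpha>, u) = 1 + idx_parity (\<alpha>, u - {k})"
          using card.remove[OF u \<open>k \<in> u\<close>] by (simp add: idx_parity_def del: card_Diff_insert)
        ultimately show ?thesis using 2 by simp
      qed
    qed
    thus ?thesis using lmult_Lam[of "gen1 m k" f]
      by (auto simp: Lam_hom_def simp del: bit_not_one_iff bit_not_zero_iff)
  qed
qed

lemma gen1_hom: "i \<in> Y' \<Longrightarrow> gen1 m i \<in> \<Lambda>h (par m i)"
  using gen1_Lam[of i]
  by (auto simp: Lam_hom_def gen1_gidx gidx_def idx_parity_def par_def tau_def Y_simps split: if_splits)

section \<open>The bracket of homogeneous fields, coefficient by coefficient\<close>

definition act :: "(nat \<Rightarrow> idx \<Rightarrow> 'a) \<Rightarrow> (idx \<Rightarrow> 'a) \<Rightarrow> (idx \<Rightarrow> 'a)" where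
  "act X f = (\<Sum>i\<in>YY. lmult p m n t (X i) (Dv i f))"

text \<open>On homogeneous fields a single pair of parities survives in the definition of
  \<open>br\<close>. As \<open>X i\<close> has parity \<open>a + par m i\<close>, the shifts by
  \<open>tau\<close> cancel and the sign depends only on \<open>a * b\<close>, which leaves the
  usual commutator formula for vector fields.\<close>

lemma br_hom:
  assumes X: "X \<in> Wh a" and Z: "Z \<in> Wh b"
  shows "bra X Z j = act X (Z j) - psign (a * b) (act Z (X j))"
proof -
  have inner_sum: "(\<Sum>a\<in>{0,1}. \<Sum>b\<in>{0,1}. br_basic p m n t a (hpart a (X i)) i b (hpart b (Z j)) j)
     = vf (lmult p m n t (X i) (Dv i (Z j))) j - psign (a * b) (vf (lmult p m n t (Z j) (Dv j (X i))) i)"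
    if i: "i \<in> YY" and j: "j \<in> YY" for i j
  proof -
    have h: "hpart a' (X i) = (if a' = a + par m i then X i else 0)"
      "hpart a' (Z j) = (if a' = b + par m j then Z j else 0)" for a'
      using X Z i j by (intro hpart_hom; simp add: W_hom_iff)+
    show ?thesis
      unfolding h by (cases a; cases b; cases "par m i"; cases "par m j";
        simp add: br_basic_def tau_par i j wscale_sg; simp add: sg_def)
  qed
  have "bra X Z = (\<Sum>i\<in>YY. \<Sum>j\<in>YY. vf (lmult p m n t (X i) (Dv i (Z j))) j)
     - psign (a * b) (\<Sum>i\<in>YY. \<Sum>j\<in>YY. vf (lmult p m n t (Z j) (Dv j (X i))) i)"
    unfolding br_def
    by (simp only: inner_sum cong: sum.cong) (cases a; cases b; simp add: sum_subtractf sum_negf sum.distrib)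
  also have "(\<Sum>i\<in>YY. \<Sum>j\<in>YY. vf (lmult p m n t (X i) (Dv i (Z j))) j)
      = (\<lambda>j. if j \<in> YY then act X (Z j) else 0)"
    by (subst sum.swap) (simp add: act_def vf_sum sum_vf fun_eq_iff)
  also have "(\<Sum>i\<in>YY. \<Sum>j\<in>YY. vf (lmult p m n t (Z j) (Dv j (X i))) i)
      = (\<lambda>j. if j \<in> YY then act Z (X j) else 0)"
    by (simp add: act_def vf_sum sum_vf fun_eq_iff)
  finally show ?thesis
    using X Z by (auto simp: psign_apply W_hom_iff act_def)
qed

lemma br_skew:
  assumes "X \<in> Wh a" "Z \<in> Wh b"
  shows "bra X Z = - psign (a * b) (bra Z X)"
  unfolding fun_eq_iff[of "bra X Z"]
  by (cases a; cases b) (use assms in \<open>simp_all add: br_hom\<close>)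

definition gfield :: "nat \<Rightarrow> nat \<Rightarrow> (nat \<Rightarrow> idx \<Rightarrow> 'a)" where
  "gfield i k = vf (gen1 m i) k"

lemma gfield_hom: "i \<in> Y' \<Longrightarrow> k \<in> YY \<Longrightarrow> gfield i k \<in> Wh (par m i + par m k)"
  using gen1_hom[of i]
  by (cases "par m k") (auto simp: W_hom_iff gfield_def vf_def Lam_hom_closed)

text \<open>The second term arises because \<open>w\<close> applied to the coefficient x_i returns
  \<open>w i\<close>. This covers i = 0 too: a field kills the constant 1, and
  \<open>w 0 = 0\<close> since 0 is not in \<open>YY\<close>.\<close>

lemma br_gfield:
  assumes i: "i \<in> Y'" and k: "k \<in> YY" and w: "w \<in> Wh c"
  shows "bra (gfield i k) w = (\<lambda>j. M i (Dv k (w j)) - (if j = k then psign ((par m i + par m k) * c) (w i) else 0))"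
proof
  fix j
  have 1: "act (gfield i k) f = M i (Dv k f)" for f
  proof -
    have "act (gfield i k) f = (\<Sum>l\<in>YY. if l = k then M i (Dv k f) else 0)"
      unfolding act_def gfield_def vf_def by (intro sum.cong) auto
    thus ?thesis using k by simp
  qed
  have 2: "act w (gfield i k j) = (if j = k then w i else 0)"
  proof (cases "j = k")
    case True
    have "act w (gfield i k j) = (\<Sum>l\<in>YY. if l = i then w i else 0)"
      unfolding act_def gfield_def vf_def using True i lmult_one[OF W_hom_Lam[OF w]]
      by (intro sum.cong) (auto simp: D_gen1)
    thus ?thesis using True i W_hom_0[OF w] by auto
  qed (simp add: act_def gfield_def vf_def)
  show "bra (gfield i k) w j = M i (Dv k (w j)) - (if j = k then psign ((par m i + par m k) * c) (w i) else 0)"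
    unfolding br_hom[OF gfield_hom[OF i k] w] 1 2 by simp
qed

lemma br_gfield_hom:
  assumes i: "i \<in> Y'" and k: "k \<in> YY" and w: "w \<in> Wh c"
  shows "bra (gfield i k) w \<in> Wh (par m i + par m k + c)"
proof -
  have "M i (Dv k (w j)) \<in> \<Lambda>h (par m i + par m k + c + par m j)" if "j \<in> YY" for j
  proof -
    have "M i (Dv k (w j)) \<in> \<Lambda>h (par m i + (c + par m j + par m k))"
      using w i k that by (intro M_hom D_hom) (auto simp: W_hom_iff)
    thus ?thesis by (simp only: ac_simps)
  qed
  moreover have "psign ((par m i + par m k) * c) (w i) \<in> \<Lambda>h (par m i + par m k + c + par m k)"
  proof (cases "i = 0")
    case True
    thus ?thesis using W_hom_0[OF w] by (simp add: Lam_hom_closed del: bit_not_one_iff)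
  next
    case False
    hence "w i \<in> \<Lambda>h (c + par m i)" using w i by (auto simp: W_hom_iff)
    thus ?thesis
      by (cases "par m k"; cases "par m i"; cases c; simp add: Lam_hom_closed)
  qed
  ultimately have "M i (Dv k (w j)) - (if j = k then psign ((par m i + par m k) * c) (w i) else 0)
      \<in> \<Lambda>h (par m i + par m k + c + par m j)" if "j \<in> YY" for j
    using that by (cases "j = k") (auto simp only: diff_conv_add_uminus intro!: Lam_hom_closed, simp_all add: Lam_hom_closed)
  thus ?thesis
    unfolding br_gfield[OF assms] W_hom_iff using w k by (auto simp: W_hom_iff)
qed

lemma M_gen1: "i \<in> Y' \<Longrightarrow> M i (gen1 m 0) = gen1 m i"
  by (rule lmult_one[OF gen1_Lam])

text \<open>For nonzero indices these are the relations of the matrix units of gl(m|n), with x_i D_k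
  in the role of the unit at (i, k); index 0 adds the translations D_k.\<close>

lemma br_gfield_gfield:
  assumes "i \<in> Y'" "k \<in> YY" "l \<in> Y'" "q \<in> YY"
  shows "bra (gfield i k) (gfield l q) = (if k = l then gfield i q else 0)
     - psign ((par m i + par m k) * (par m l + par m q)) (if q = i then gfield l k else 0)"
  unfolding br_gfield[OF assms(1,2) gfield_hom[OF assms(3,4)]]
  using assms by (auto simp: gfield_def vf_def fun_eq_iff D_gen1 M_gen1 psign_apply)

text \<open>The third field is an arbitrary homogeneous one because it will be a value of \<phi>,
  about which nothing but its parity is known.\<close>

lemma jacobi_gfield:
  assumes i: "i \<in> Y'" and k: "k \<in> YY" and l: "l \<in> Y'" and q: "q \<in> YY" and w: "w \<in> Wh c"
  shows "bra (gfield i k) (bra (gfield l q) w) = bra (bra (gfield i k) (gfield l q)) w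
    + psign ((par m i + par m k) * (par m l + par m q)) (bra (gfield l q) (bra (gfield i k) w))"
proof
  fix j
  have zero: "bra 0 w = 0"
    using br_add_left[of p m n t 0 0 w] by simp
  have neg: "bra (- x) w = - bra x w" for x
    using br_add_left[of p m n t x "- x" w] zero by (simp add: eq_neg_iff_add_eq_0 add.commute)
  have br_sub: "bra (x - y) w = bra x w - bra y w" for x y
    using br_add_left[of p m n t x "- y" w] neg by simp
  have br_psign: "bra (psign a x) w = psign a (bra x w)" for a x
    by (simp add: psign_def neg)
  note wL = W_hom_Lam[OF w]
  have L: "Dv k (w j) \<in> \<Lambda>" "Dv q (w j) \<in> \<Lambda>" for j
    using wL by (auto intro: D_Lam)
  have DM: "Dv k (M l (Dv q (w j))) = (if k = l then Dv q (w j) else 0)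
       + psign (par m k * par m l) (M l (Dv k (Dv q (w j))))"
    "Dv q (M i (Dv k (w j))) = (if q = i then Dv k (w j) else 0)
       + psign (par m q * par m i) (M i (Dv q (Dv k (w j))))" for j
    using D_M[OF l k L(2)] D_M[OF i q L(1)] by auto
  have DD: "Dv q (Dv k (w j)) = psign (par m q * par m k) (Dv k (Dv q (w j)))" for j
    by (rule D_D[OF k q wL])
  have MM: "M l (M i (Dv k (Dv q (w j)))) = psign (par m l * par m i) (M i (M l (Dv k (Dv q (w j)))))" for j
    using i l wL by (intro M_M D_Lam) auto
  have o: "bra (gfield i k) (bra (gfield l q) w) j =
      M i (Dv k (M l (Dv q (w j)) - (if j = q then psign ((par m l + par m q) * c) (w l) else 0)))
      - (if j = k then psign ((par m i + par m k) * (par m l + par m q + c))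
           (M l (Dv q (w i)) - (if q = i then psign ((par m l + par m q) * c) (w l) else 0)) else 0)"
    "bra (gfield l q) (bra (gfield i k) w) j =
      M l (Dv q (M i (Dv k (w j)) - (if j = k then psign ((par m i + par m k) * c) (w i) else 0)))
      - (if j = q then psign ((par m l + par m q) * (par m i + par m k + c))
           (M i (Dv k (w l)) - (if k = l then psign ((par m i + par m k) * c) (w i) else 0)) else 0)"
    by (subst br_gfield[OF i k br_gfield_hom[OF l q w]], subst (1 2) br_gfield[OF l q w], simp only: eq_commute)
       (subst br_gfield[OF l q br_gfield_hom[OF i k w]], subst (1 2) br_gfield[OF i k w], simp only: eq_commute)
  \<comment> \<open>In both double brackets the second-order term is brought to the common order
    \<open>M i\<close>, \<open>M l\<close>, \<open>Dv k\<close>, \<open>Dv q\<close>. The reordering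
    signs cancel the difference of these terms, and only contractions of equal indices
    remain.\<close>
  have o1: "bra (gfield i k) (bra (gfield l q) w) j =
      (if k = l then M i (Dv q (w j)) else 0)
      + psign (par m k * par m l) (M i (M l (Dv k (Dv q (w j)))))
      - (if j = q then psign ((par m l + par m q) * c) (M i (Dv k (w l))) else 0)
      - (if j = k then psign ((par m i + par m k) * (par m l + par m q + c))
           (M l (Dv q (w i)) - (if q = i then psign ((par m l + par m q) * c) (w l) else 0)) else 0)"
    unfolding o by (simp only: D_diff lmult_diff if_distrib[of "Dv k"] if_distrib[of "M i"]
      D_psign lmult_psign DM D_0 lmult_0 lmult_add_right)
  have o2: "bra (gfield l q) (bra (gfield i k) w) j =
      (if q = i then M l (Dv k (w j)) else 0)
      + psign (par m q * par m i + (par m q * par m k + par m l * par m i)) (M i (M l (Dv k (Dv q (w j)))))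
      - (if j = k then psign ((par m i + par m k) * c) (M l (Dv q (w i))) else 0)
      - (if j = q then psign ((par m l + par m q) * (par m i + par m k + c))
           (M i (Dv k (w l)) - (if k = l then psign ((par m i + par m k) * c) (w i) else 0)) else 0)"
    unfolding o by (simp only: D_diff lmult_diff if_distrib[of "Dv q"] if_distrib[of "M l"]
      D_psign lmult_psign DM DD MM D_0 lmult_0 lmult_add_right psign_psign add.assoc)
  have t: "bra (bra (gfield i k) (gfield l q)) w j = (if k = l then bra (gfield i q) w j else 0)
     - psign ((par m i + par m k) * (par m l + par m q)) (if q = i then bra (gfield l k) w j else 0)"
    unfolding br_gfield_gfield[OF i k l q] by (simp add: br_sub br_psign psign_apply zero)
  have "bra (gfield i k) (bra (gfield l q) w) j = bra (bra (gfield i k) (gfield l q)) w j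
    + psign ((par m i + par m k) * (par m l + par m q)) (bra (gfield l q) (bra (gfield i k) w) j)"
    unfolding o1 o2 t br_gfield[OF i q w] br_gfield[OF l k w]
    by (rule sign_identity) auto
  thus "bra (gfield i k) (bra (gfield l q) w) j = (bra (bra (gfield i k) (gfield l q)) w
    + psign ((par m i + par m k) * (par m l + par m q)) (bra (gfield l q) (bra (gfield i k) w))) j"
    by (simp only: plus_fun_apply psign_apply)
qed

section \<open>Test fields of degree at most zero inside S\<close>

lemma gen1_gen: "i \<in> YY \<Longrightarrow> gen m i = gen1 m i"
  by (simp add: gen1_def Y_simps)

lemma avoid_three: "\<exists>r\<in>YY. r \<noteq> a \<and> r \<noteq> b \<and> r \<noteq> c"
proof -
  have "card YY = m + n"
    by (simp add: Y_def Y0_def Y1_def card_Un_disjoint)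
  moreover have "card {a, b, c} \<le> 3" by (simp add: card_insert_if)
  ultimately have "\<not> YY \<subseteq> {a, b, c}"
    using card_mono[of "{a, b, c}" YY] m n by auto
  thus ?thesis by auto
qed

text \<open>A single x_a D_a has superdivergence 1 for even a and -1 for odd a, hence is not in S.
  One index of each parity makes the sum divergence-free.\<close>

definition torus :: "nat \<Rightarrow> nat \<Rightarrow> (nat \<Rightarrow> idx \<Rightarrow> 'a)" where
  "torus a b = gfield a a + gfield b b"

text \<open>This family is not closed under the bracket: for even i and k, [x_i D_k, x_k D_i] = x_i
  D_i - x_k D_k is not listed. It suffices that brackets land in S, which is why \<open>L\<close>
  and \<open>G\<close> are kept apart in the locale.\<close>

definition low :: "bit \<Rightarrow> (nat \<Rightarrow> idx \<Rightarrow> 'a) set" where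
  "low c = {gfield i k | i k. i \<in> Y' \<and> k \<in> YY \<and> i \<noteq> k \<and> par m i + par m k = c}
     \<union> {torus a b | a b. a \<in> Y0 m \<and> b \<in> Y1 m n \<and> c = 0}"

lemma gfield_low: "i \<in> Y' \<Longrightarrow> k \<in> YY \<Longrightarrow> i \<noteq> k \<Longrightarrow> gfield i k \<in> low (par m i + par m k)"
  unfolding low_def by blast

lemma torus_low: "a \<in> Y0 m \<Longrightarrow> b \<in> Y1 m n \<Longrightarrow> torus a b \<in> low 0"
  unfolding low_def by blast

lemma Y01 [simp]: "a \<in> Y0 m \<Longrightarrow> a \<in> YY" "b \<in> Y1 m n \<Longrightarrow> b \<in> YY"
  by (auto simp: Y_def)

lemma Dij_eq:
  assumes "f \<in> \<Lambda>h a" "i \<in> YY" "j \<in> YY"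
  shows "Dij p m n t i j f = - psign (a * (par m i + par m j)) (vf (Dv j f) i)
    + psign (par m i * par m j) (vf (Dv i f) j)"
  unfolding Dij_def hpart_hom[OF assms(1)]
  by (cases a) (simp_all add: Dij_hom_def wscale_sg tau_par assms)

text \<open>D_k kills x_j x_i, so only the term with D_j(x_j x_i) = x_i is left. The auxiliary index
  j thus exhibits x_i D_k as an element of S.\<close>

lemma Dij_M_gen1:
  assumes "j \<in> YY" "i \<in> Y'" "k \<in> YY" "j \<noteq> i" "j \<noteq> k" "i \<noteq> k"
  shows "Dij p m n t j k (M j (gen1 m i)) = psign (par m j * par m k) (gfield i k)"
  using assms Dij_eq[OF M_hom[OF gen1_hom[of i], of j], of j k]
  by (simp add: D_M gen1_Lam D_gen1 gfield_def)

lemma Dij_torus: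
  assumes "a \<in> Y0 m" "b \<in> Y1 m n"
  shows "Dij p m n t a b (M a (gen1 m b)) = torus a b"
proof -
  have ab: "a \<in> YY" "b \<in> YY" "a \<noteq> b" "par m a = 0" "par m b = 1"
    using assms by (auto simp: Y_simps par_def tau_def)
  show ?thesis
    using ab Dij_eq[OF M_hom[OF gen1_hom[of b], of a], of a b]
    by (simp add: D_M gen1_Lam D_gen1 M_gen1 gfield_def torus_def)
qed

lemma Dij_S: "i \<in> YY \<Longrightarrow> j \<in> YY \<Longrightarrow> f \<in> \<Lambda> \<Longrightarrow> Dij p m n t i j f \<in> SS"
  unfolding S_def by (rule wvec.span_base) blast

lemma S_closed: "0 \<in> SS" "x \<in> SS \<Longrightarrow> y \<in> SS \<Longrightarrow> x + y \<in> SS" "x \<in> SS \<Longrightarrow> y \<in> SS \<Longrightarrow> x - y \<in> SS"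
  "x \<in> SS \<Longrightarrow> - x \<in> SS"
  unfolding S_def by (auto intro: wvec.span_zero wvec.span_add wvec.span_diff wvec.span_neg)

lemma S_psign: "x \<in> SS \<Longrightarrow> psign a x \<in> SS"
  by (simp add: psign_def S_closed)

lemma gfield_S:
  assumes "i \<in> Y'" "k \<in> YY" "i \<noteq> k"
  shows "gfield i k \<in> SS"
proof -
  obtain j where j: "j \<in> YY" "j \<noteq> i" "j \<noteq> k" using avoid_three[of i k k] by auto
  have "Dij p m n t j k (M j (gen1 m i)) \<in> SS"
    using j assms by (intro Dij_S lmult_Lam)
  hence "psign (par m j * par m k) (psign (par m j * par m k) (gfield i k)) \<in> SS"
    using Dij_M_gen1[of j i k] j assms by (simp add: S_psign del: psign_simps)
  thus ?thesis by (simp add: psign_psign)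
qed

lemma torus_S: "a \<in> Y0 m \<Longrightarrow> b \<in> Y1 m n \<Longrightarrow> torus a b \<in> SS"
  using Dij_torus[of a b] Dij_S[OF Y01, of a b "M a (gen1 m b)"] lmult_Lam by simp

lemma torus_hom: "a \<in> Y0 m \<Longrightarrow> b \<in> Y1 m n \<Longrightarrow> torus a b \<in> Wh 0"
  using gfield_hom[of a a] gfield_hom[of b b] W_hom_closed(2)[of "gfield a a" 0 "gfield b b"] by (simp add: torus_def)

lemma low_W_hom: "x \<in> low c \<Longrightarrow> x \<in> Wh c"
  unfolding low_def using gfield_hom torus_hom by auto

lemma low_S_hom: "x \<in> low c \<Longrightarrow> x \<in> Sh c"
  using low_W_hom[of x c] unfolding S_hom_def low_def using gfield_S torus_S by auto

lemma S_hom_W_hom: "x \<in> Sh c \<Longrightarrow> x \<in> Wh c"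
  by (simp add: S_hom_def)

lemma low_cases:
  assumes "x \<in> low c"
  obtains i k where "x = gfield i k" "i \<in> Y'" "k \<in> YY" "i \<noteq> k" "c = par m i + par m k"
  | a b where "x = torus a b" "a \<in> Y0 m" "b \<in> Y1 m n" "c = 0"
  using assms unfolding low_def by blast

text \<open>Reduces additive identities to the fields x_i D_k. The two summands of a torus element
  have the same parity, so the signs agree.\<close>

lemma low_gfield_sum:
  assumes "x \<in> low c"
  obtains i k where "i \<in> Y'" "k \<in> YY" "x = gfield i k" "c = par m i + par m k"
  | i k i' k' where "i \<in> Y'" "k \<in> YY" "i' \<in> Y'" "k' \<in> YY" "x = gfield i k + gfield i' k'"
     "c = par m i + par m k" "c = par m i' + par m k'"
  using assms
proof (cases rule: low_cases)
  case (2 a b)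
  show thesis by (rule that(2)[of a a b b]) (use 2 in \<open>auto simp: torus_def\<close>)
qed (use that in auto)

lemma br_low_W_hom:
  assumes x: "x \<in> low a" and w: "w \<in> Wh c"
  shows "bra x w \<in> Wh (a + c)"
  using x
proof (cases rule: low_gfield_sum)
  case 1
  thus ?thesis using br_gfield_hom[OF _ _ w] by blast
next
  case (2 i k i' k')
  have "bra (gfield i k) w \<in> Wh (a + c)" "bra (gfield i' k') w \<in> Wh (a + c)"
    using br_gfield_hom[OF 2(1,2) w] br_gfield_hom[OF 2(3,4) w] 2(6,7) by (metis, metis)
  thus ?thesis unfolding 2(5) br_add_left by (rule W_hom_closed)
qed

lemma jacobi_gfield_low:
  assumes x: "i \<in> Y'" "k \<in> YY" and y: "y \<in> low b" and w: "w \<in> Wh c"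
  shows "bra (gfield i k) (bra y w) = bra (bra (gfield i k) y) w
    + psign ((par m i + par m k) * b) (bra y (bra (gfield i k) w))"
  using y
proof (cases rule: low_gfield_sum)
  case (1 l q)
  show ?thesis unfolding 1(3,4) by (rule jacobi_gfield[OF x 1(1,2) w])
next
  case (2 l q l' q')
  have "bra (gfield i k) (bra (gfield l q) w) = bra (bra (gfield i k) (gfield l q)) w
      + psign ((par m i + par m k) * b) (bra (gfield l q) (bra (gfield i k) w))"
    unfolding 2(6) by (rule jacobi_gfield[OF x 2(1,2) w])
  moreover have "bra (gfield i k) (bra (gfield l' q') w) = bra (bra (gfield i k) (gfield l' q')) w
      + psign ((par m i + par m k) * b) (bra (gfield l' q') (bra (gfield i k) w))"
    unfolding 2(7) by (rule jacobi_gfield[OF x 2(3,4) w])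
  ultimately show ?thesis
    unfolding 2(5) br_add_left br_add_right psign_add by (simp only: ac_simps)
qed

lemma jacobi_low:
  assumes x: "x \<in> low a" and y: "y \<in> low b" and w: "w \<in> Wh c"
  shows "bra x (bra y w) = bra (bra x y) w + psign (a * b) (bra y (bra x w))"
  using x
proof (cases rule: low_gfield_sum)
  case (1 l q)
  show ?thesis unfolding 1(3,4) by (rule jacobi_gfield_low[OF 1(1,2) y w])
next
  case (2 l q l' q')
  have "bra (gfield l q) (bra y w) = bra (bra (gfield l q) y) w + psign (a * b) (bra y (bra (gfield l q) w))"
    unfolding 2(6) by (rule jacobi_gfield_low[OF 2(1,2) y w])
  moreover have "bra (gfield l' q') (bra y w) = bra (bra (gfield l' q') y) w + psign (a * b) (bra y (bra (gfield l' q') w))"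
    unfolding 2(7) by (rule jacobi_gfield_low[OF 2(3,4) y w])
  ultimately show ?thesis
    unfolding 2(5) br_add_left br_add_right psign_add by (simp only: ac_simps)
qed

lemma bra_minus [simp]: "bra x (- y) = - bra x y" "bra x 0 = 0" "bra 0 x = 0"
proof -
  show z: "bra x 0 = 0" "bra 0 x = 0"
    using br_add_right[of p m n t x 0 0] br_add_left[of p m n t 0 0 x] by auto
  show "bra x (- y) = - bra x y"
    using br_add_right[of p m n t x y "- y"] z by (simp add: eq_neg_iff_add_eq_0 add.commute)
qed

lemma br_torus_gfield:
  assumes "a \<in> Y0 m" "b \<in> Y1 m n" "l \<in> Y'" "q \<in> YY"
  shows "bra (torus a b) (gfield l q) = (if l = a \<or> l = b then gfield l q else 0) - (if q = a \<or> q = b then gfield l q else 0)"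
proof -
  have "a \<noteq> b" using assms by (auto simp: Y_simps)
  thus ?thesis using assms by (auto simp: torus_def br_add_left br_gfield_gfield)
qed

lemma br_torus_torus:
  assumes "a \<in> Y0 m" "b \<in> Y1 m n" "a' \<in> Y0 m" "b' \<in> Y1 m n"
  shows "bra (torus a b) (torus a' b') = 0"
  unfolding torus_def[of a' b'] br_add_right using assms by (auto simp: br_torus_gfield)

text \<open>These supertraceless diagonal fields are the brackets [x_i D_k, x_k D_i]. For opposite
  parities they are torus elements; for equal parities they are differences of two torus elements
  sharing an auxiliary index of the other parity, namely m + 1 or 1.\<close>

lemma trace_S:
  assumes i: "i \<in> YY" and k: "k \<in> YY"
  shows "gfield i i - psign (par m i + par m k) (gfield k k) \<in> SS"
proof -
  have b: "Suc m \<in> Y1 m n" and a: "1 \<in> Y0 m" using m n by (auto simp: Y_simps)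
  show ?thesis
    using i
  proof (cases rule: Y_cases)
    case i0: 1
    from k show ?thesis
    proof (cases rule: Y_cases)
      case 1
      have "torus i (Suc m) - torus k (Suc m) \<in> SS" by (intro S_closed torus_S i0 1 b)
      thus ?thesis using 1 i0 by (simp add: torus_def)
    next
      case 2
      have "torus i k \<in> SS" by (intro torus_S i0 2)
      thus ?thesis using 2 i0 by (simp add: torus_def)
    qed
  next
    case i1: 2
    from k show ?thesis
    proof (cases rule: Y_cases)
      case 1
      have "torus k i \<in> SS" by (intro torus_S i1 1)
      thus ?thesis using 1 i1 by (simp add: torus_def add.commute)
    next
      case 2
      have "torus 1 i - torus 1 k \<in> SS" by (intro S_closed torus_S i1 2 a)
      thus ?thesis using 2 i1 by (simp add: torus_def)
    qed
  qed
qed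

lemma br_low_S: "x \<in> low a \<Longrightarrow> y \<in> low b \<Longrightarrow> bra x y \<in> SS"
proof -
  have H: "bra (torus a b) y \<in> SS" if "a \<in> Y0 m" "b \<in> Y1 m n" "y \<in> low c" for a b c y
    using that(3)
    by (cases rule: low_cases) (use that in \<open>auto simp: br_torus_gfield br_torus_torus S_closed gfield_S\<close>)
  assume x: "x \<in> low a" and y: "y \<in> low b"
  from x show ?thesis
  proof (cases rule: low_cases)
    case (1 i k)
    note x' = this
    from y show ?thesis
    proof (cases rule: low_cases)
      case (1 l q)
      show ?thesis
      proof (cases "k = l \<and> q = i")
        case True
        hence "bra x y = gfield i i - psign (par m i + par m k) (gfield k k)"
          using 1 x' br_gfield_gfield[of i k l q] by (cases "par m i"; cases "par m k"; auto)
        thus ?thesis using trace_S[of i k] True x' 1 by auto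
      next
        case False
        have "gfield i q \<in> SS \<or> q = i" "gfield l k \<in> SS \<or> k = l" using 1 x' gfield_S by auto
        thus ?thesis using False 1 x' br_gfield_gfield[of i k l q] by (auto simp: S_closed S_psign)
      qed
    next
      case 2
      have "bra x y = - psign (a * b) (bra y x)"
        by (rule br_skew[OF low_W_hom[OF x] low_W_hom[OF y]])
      thus ?thesis using H[OF 2(2,3) x] 2 by (simp add: S_closed)
    qed
  next
    case 2
    thus ?thesis using H y by blast
  qed
qed

lemma br_low_S_hom: "x \<in> low a \<Longrightarrow> y \<in> low b \<Longrightarrow> bra x y \<in> Sh (a + b)"
  using br_low_S br_low_W_hom low_W_hom by (simp add: S_hom_def)

text \<open>Commuting with every D_q leaves only constant coefficients. For constant coefficients
  the q-component of [x_l D_q, w] is the coefficient \<open>w l\<close> up to sign, so that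
  coefficient vanishes as well.\<close>

lemma centralizer_trivial:
  assumes w: "w \<in> Wh c" and comm: "\<And>l q. l \<in> Y' \<Longrightarrow> q \<in> YY \<Longrightarrow> l \<noteq> q \<Longrightarrow> bra (gfield l q) w = 0"
  shows "w = 0"
proof
  have D0: "Dv q (w j) = 0" if q: "q \<in> YY" for q j
  proof -
    have "q \<noteq> 0" using q by (simp add: Y_simps)
    hence "bra (gfield 0 q) w j = 0" using comm[of 0 q] q by simp
    thus ?thesis
      using q W_hom_0[OF w] D_Lam[OF W_hom_Lam[OF w]] by (simp add: br_gfield[OF _ q w] M_one split: if_splits)
  qed
  fix l show "w l = 0 l"
  proof (cases "l \<in> YY")
    case True
    then obtain q where q: "q \<in> YY" "q \<noteq> l" using avoid_three[of l l l] by auto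
    have "bra (gfield l q) w q = 0" using comm[of l q] True q by simp
    thus ?thesis using D0 q True by (simp add: br_gfield[OF _ q(1) w])
  qed (use w in \<open>simp add: W_hom_iff\<close>)
qed

text \<open>x_a D_a and x_b D_b are Euler operators, so monomial fields are weight vectors; the
  subtracted term is the negative weight of D_j. The exponent \<open>\<alpha> a\<close> enters only
  through its image in the field.\<close>

lemma br_torus_coeff:
  assumes a: "a \<in> Y0 m" and b: "b \<in> Y1 m n" and w: "w \<in> Wh c"
  shows "bra (torus a b) w j (\<alpha>, u) =
    (of_nat (\<alpha> a) + (if b \<in> u then 1 else 0) - (if j = a \<or> j = b then 1 else 0)) * w j (\<alpha>, u)"
proof -
  have ab: "a \<noteq> b" "a \<in> YY" "b \<in> YY" "b \<notin> Y0 m" using a b by (auto simp: Y_simps)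
  note wL = W_hom_Lam[OF w]
  have 1: "M a (Dv a (w j)) (\<alpha>, u) = of_nat (\<alpha> a) * w j (\<alpha>, u)"
  proof (cases "\<alpha> a = 0")
    case False
    hence "\<alpha> - eps a + eps a = \<alpha>" by (auto simp: fun_eq_iff eps_def)
    thus ?thesis using a wL D_Lam[OF wL] by (simp add: M_even D_even)
  qed (use a wL D_Lam[OF wL] in \<open>simp add: M_even\<close>)
  have 2: "M b (Dv b (w j)) (\<alpha>, u) = (if b \<in> u then w j (\<alpha>, u) else 0)"
    using b ab wL D_Lam[OF wL] by (simp add: M_odd D_odd insert_absorb)
  show ?thesis
    using ab 1 2 by (auto simp: torus_def br_add_left br_gfield[OF _ _ w] algebra_simps)
qed

section \<open>Weights\<close>

lemma two_ne_0: "(2::'a) \<noteq> 0"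
proof
  assume "(2::'a) = 0"
  hence "of_nat 2 = (0::'a)" by simp
  hence "p dvd 2" using char by (simp only: of_nat_eq_0_iff_char_dvd)
  thus False using p by (auto dest: dvd_imp_le)
qed

lemma two_torsion_free:
  fixes v :: "nat \<Rightarrow> idx \<Rightarrow> 'a"
  assumes "v + v = 0"
  shows "v = 0"
proof (intro ext)
  fix i b
  have "v i b + v i b = 0" using assms by (metis plus_fun_apply zero_fun_apply)
  hence "2 * v i b = 0" by simp
  thus "v i b = 0 i b" using two_ne_0 by simp
qed

section \<open>Values of a skew-symmetric super-biderivation of S\<close>

context
  fixes \<phi> :: "(nat \<Rightarrow> idx \<Rightarrow> 'a) \<Rightarrow> (nat \<Rightarrow> idx \<Rightarrow> 'a) \<Rightarrow> (nat \<Rightarrow> idx \<Rightarrow> 'a)" and \<gamma> :: bit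
  assumes phi: "bilinear_on wscale SS \<phi>"
    and hom: "homogeneous_of_degree Sh \<gamma> \<phi>"
    and der: "\<And>a b c x y z. x \<in> Sh a \<Longrightarrow> y \<in> Sh b \<Longrightarrow> z \<in> Sh c \<Longrightarrow>
      \<phi> x (bra y z) = bra (\<phi> x y) z + psign ((\<gamma> + a) * b) (bra y (\<phi> x z))"
    and skew: "\<And>a b x y. x \<in> Sh a \<Longrightarrow> y \<in> Sh b \<Longrightarrow>
      \<phi> x y = - psign (\<gamma> * a + \<gamma> * b + a * b) (\<phi> y x)"
begin

interpretation skew_biderivation_on bra \<phi> low Sh Wh \<gamma>
proof
  show "low a \<subseteq> Sh a" "Sh a \<subseteq> Wh a" for a
    using low_S_hom S_hom_W_hom by blast+
  show "\<phi> x y \<in> Sh (a + b + \<gamma>)" if "x \<in> Sh a" "y \<in> Sh b" for a b x y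
    using hom that unfolding homogeneous_of_degree_def by blast
qed (fact two_torsion_free br_add_left br_add_right br_low_S_hom br_low_W_hom br_skew jacobi_low der skew)+

lemma phi_W_hom: "x \<in> low a \<Longrightarrow> y \<in> low b \<Longrightarrow> \<phi> x y \<in> Wh (a + b + \<gamma>)"
  by (intro S_hom_W_hom phi_G low_S_hom)

lemma phi_minus: "x \<in> SS \<Longrightarrow> y \<in> SS \<Longrightarrow> \<phi> x (- y) = - \<phi> x y"
  and phi_zero: "x \<in> SS \<Longrightarrow> \<phi> x 0 = 0"
proof -
  show z: "\<phi> x 0 = 0" if x: "x \<in> SS" for x
  proof -
    have "\<phi> x (0 + 0) = \<phi> x 0 + \<phi> x 0"
      using phi x S_closed(1) unfolding bilinear_on_def by blast
    thus ?thesis by simp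
  qed
  assume x: "x \<in> SS" and y: "y \<in> SS"
  have "\<phi> x (y + - y) = \<phi> x y + \<phi> x (- y)"
    using phi x y S_closed(4)[OF y] unfolding bilinear_on_def by blast
  thus "\<phi> x (- y) = - \<phi> x y" using z[OF x] by (simp add: eq_neg_iff_add_eq_0 add.commute)
qed

lemma low_SS: "x \<in> low a \<Longrightarrow> x \<in> SS"
  using low_S_hom by (auto simp: S_hom_def)

lemma gfield_bracket:
  assumes "l \<in> Y'" "q \<in> YY" "r \<in> YY" "l \<noteq> q"
  shows "bra (gfield l r) (gfield r q) = gfield l q"
  using assms by (simp add: br_gfield_gfield)

lemma phi_eq_0:
  assumes x: "x \<in> low a" and y: "y \<in> low b" and 0: "bra x y = 0"
  shows "\<phi> x y = 0"
proof (rule centralizer_trivial[OF phi_W_hom[OF x y]])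
  fix l q assume lq: "l \<in> Y'" "q \<in> YY" "l \<noteq> q"
  \<comment> \<open>A third index r keeps both factors of x_l D_q = [x_l D_r, x_r D_q] off the
    diagonal, hence in \<open>low\<close>.\<close>
  obtain r where r: "r \<in> YY" "r \<noteq> l" "r \<noteq> q" using avoid_three[of l q q] by auto
  have "bra (bra (gfield l r) (gfield r q)) (\<phi> x y) = 0"
    by (rule br_phi_br_eq_0[OF x y gfield_low gfield_low]) (use lq r 0 in auto)
  thus "bra (gfield l q) (\<phi> x y) = 0"
    using lq r by (simp add: gfield_bracket)
qed

text \<open>The scalar is read off as the coefficient of \<phi>(H, E) at the only monomial of E.
  Both parities of \<phi> are covered at once; for odd \<phi> the parity of the value forces this
  coefficient to be zero.\<close>

lemma phi_multiple:
  assumes k0: "k0 \<in> Y0 m" and k1: "k1 \<in> Y1 m n" and i0: "i0 \<in> Y0 m" and ne: "i0 \<noteq> k0"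
  shows "\<phi> (torus k0 k1) (gfield k1 i0) = wscale (\<phi> (torus k0 k1) (gfield k1 i0) i0 (0, {k1})) (gfield k1 i0)"
proof -
  define H where "H = torus k0 k1"
  define E where "E = gfield k1 i0"
  define X where "X = \<phi> H E"
  have nn: "k1 \<noteq> i0" "k1 \<noteq> k0" "k1 \<noteq> 0" "i0 \<noteq> 0"
    using k0 k1 i0 by (auto simp: Y_simps)
  have Y: "k1 \<in> YY" "i0 \<in> YY" "k0 \<in> YY" using k0 k1 i0 by auto
  have H: "H \<in> low 0" unfolding H_def by (rule torus_low[OF k0 k1])
  have E: "E \<in> low (par m k1 + par m i0)" unfolding E_def using gfield_low[of k1 i0] nn Y by simp
  have HE: "bra H E = E"
    unfolding H_def E_def using br_torus_gfield[OF k0 k1] Y nn ne by simp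
  have XW: "X \<in> Wh (0 + (par m k1 + par m i0) + \<gamma>)"
    unfolding X_def by (rule phi_W_hom[OF H E])
  have D0: "Dv k (X j) = 0" if k: "k \<in> YY" "k \<noteq> k1" for k j
  proof -
    \<comment> \<open>Avoiding k1 makes D_r commute with E, avoiding i0 (with k different from k1)
      makes x_r D_k commute with E. Such r exists since m + n is at least 4.\<close>
    obtain r where r: "r \<in> YY" "r \<noteq> k" "r \<noteq> k1" "r \<noteq> i0"
      using avoid_three[of k k1 i0] by auto
    have r0: "r \<noteq> 0" "k \<noteq> 0" using r k by (auto simp: Y_simps)
    define u where "u = gfield 0 r"
    define v where "v = gfield r k"
    have u: "u \<in> low (par m 0 + par m r)" and v: "v \<in> low (par m r + par m k)"
      unfolding u_def v_def using gfield_low[of 0 r] gfield_low[of r k] r r0 k by simp_all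
    have uE: "bra u E = 0" and vE: "bra v E = 0"
      unfolding u_def v_def E_def using r r0 k nn Y by (simp_all add: br_gfield_gfield)
    have "0 = \<phi> u (bra v E)"
      using vE phi_zero[OF low_SS[OF u]] by simp
    also have "\<dots> = bra (\<phi> u v) E"
      using der[OF low_S_hom[OF u] low_S_hom[OF v] low_S_hom[OF E]] phi_eq_0[OF u E uE] by simp
    finally have "bra E (\<phi> u v) = 0"
      using br_skew[OF low_W_hom[OF E] phi_W_hom[OF u v]] by simp
    hence "bra (bra u v) X = 0"
      unfolding X_def using br_phi_br_eq_0[OF H E u v] HE by simp
    hence "bra (gfield 0 k) X j = 0"
      unfolding u_def v_def using gfield_bracket[of 0 k r] r r0 k by simp
    thus ?thesis
      using k W_hom_0[OF XW] D_Lam[OF W_hom_Lam[OF XW]]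
      by (simp add: br_gfield[OF _ k(1) XW] M_one split: if_splits)
  qed
  \<comment> \<open>Torus elements commute, so \<phi>(H, h) = 0 for each of them. The derivation
    rule then says that \<phi>(H, -) commutes with ad h, and X inherits the weights of E.\<close>
  have weight: "bra (torus a b) X = \<phi> H (bra (torus a b) E)" if "a \<in> Y0 m" "b \<in> Y1 m n" for a b
  proof -
    have h: "torus a b \<in> low 0" by (rule torus_low[OF that])
    have "\<phi> H (torus a b) = 0"
      by (rule phi_eq_0[OF H h]) (unfold H_def, rule br_torus_torus[OF k0 k1 that])
    thus ?thesis
      using der[OF low_S_hom[OF H] low_S_hom[OF h] low_S_hom[OF E]] by (simp add: X_def)
  qed
  \<comment> \<open>A second odd index, available because n is at least 2, gives torus elements that
    do not involve k1.\<close>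
  obtain k' where k': "k' \<in> Y1 m n" "k' \<noteq> k1"
    using n that[of "m + 1"] that[of "m + 2"] by (cases "k1 = m + 1") (auto simp: Y_simps)
  have k'n: "k' \<noteq> k0" "k' \<noteq> i0" "k' \<in> YY" using k' k0 i0 by (auto simp: Y_simps)
  have h1: "bra (torus k0 k1) X = X"
    using weight[OF k0 k1] HE by (simp add: X_def H_def)
  have h2: "bra (torus i0 k') X = - X"
    using weight[OF i0 k'(1)] br_torus_gfield[OF i0 k'(1), of k1 i0] Y nn k' phi_minus[OF low_SS[OF H] low_SS[OF E]]
    by (simp add: X_def E_def)
  have h3: "bra (torus k0 k') X = 0"
    using weight[OF k0 k'(1)] br_torus_gfield[OF k0 k'(1), of k1 i0] Y nn k' k'n ne phi_zero[OF low_SS[OF H]]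
    by (simp add: E_def)
  have supp: "\<alpha> = 0 \<and> u = {k1} \<and> j = i0" if nz: "X j (\<alpha>, u) \<noteq> 0" for j \<alpha> u
  proof -
    note XL = W_hom_Lam[OF XW]
    have "(\<alpha>, u) \<in> BB" using Lam_0[OF XL] nz by blast
    hence b: "\<alpha> \<in> A p m t" "u \<subseteq> Y1 m n" by (auto simp: basis_def B_def)
    have "\<alpha> k = 0" for k
    proof (rule ccontr)
      assume k: "\<alpha> k \<noteq> 0"
      hence kY: "k \<in> Y0 m" using b by (auto simp: A_def)
      hence "k \<noteq> k1" using k1 by (auto simp: Y_simps)
      moreover have "\<alpha> - eps k + eps k = \<alpha>" using k by (auto simp: fun_eq_iff eps_def)
      ultimately show False
        using D0[of k j] kY D_even[OF XL kY, of j "\<alpha> - eps k" u] nz by simp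
    qed
    hence \<alpha>: "\<alpha> = 0" by auto
    have "k = k1" if k: "k \<in> u" for k
    proof (rule ccontr)
      assume "k \<noteq> k1"
      have "k \<in> YY" "k \<notin> Y0 m" using b k by (auto simp: Y_simps)
      hence "sign_below k u * X j (\<alpha>, u) = 0"
        using D0[of k j] \<open>k \<noteq> k1\<close> D_odd[OF XL \<open>k \<notin> Y0 m\<close>, of j \<alpha> "u - {k}"] k
        by (simp add: insert_absorb)
      thus False using nz by (simp add: sign_below_def)
    qed
    hence u: "u = {} \<or> u = {k1}" by auto
    \<comment> \<open>Now \<alpha> = 0 and u is empty or {k1}. Weight 1 forces u = {k1}, since -1
      differs from 1 for p > 2; weight -1 leaves j = i0 or j = k'; weight 0 excludes k'.\<close>
    have e1: "(if k1 \<in> u then 1 else 0) - (if j = k0 \<or> j = k1 then 1 else 0) = (1::'a)"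
      using br_torus_coeff[OF k0 k1 XW, of j \<alpha> u] nz \<alpha> unfolding h1 by simp
    have e2: "(if k' \<in> u then 1 else 0) - (if j = i0 \<or> j = k' then 1 else 0) = (- 1::'a)"
    proof (rule mult_right_cancel[OF nz, THEN iffD1])
      show "((if k' \<in> u then 1 else 0) - (if j = i0 \<or> j = k' then 1 else 0)) * X j (\<alpha>, u)
          = - 1 * X j (\<alpha>, u)"
        using br_torus_coeff[OF i0 k'(1) XW, of j \<alpha> u] \<alpha> unfolding h2 by (simp split del: if_split)
    qed
    have e3: "(if k' \<in> u then 1 else 0) - (if j = k0 \<or> j = k' then 1 else 0) = (0::'a)"
      using br_torus_coeff[OF k0 k'(1) XW, of j \<alpha> u] nz \<alpha> unfolding h3 by simp
    have "(-1::'a) \<noteq> 1" using two_ne_0 by (metis add.right_inverse one_add_one)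
    thus ?thesis using e1 e2 e3 u k' \<alpha> by (auto split: if_splits)
  qed
  have "X = wscale (X i0 (0, {k1})) E"
  proof (intro ext)
    fix j and b :: idx
    obtain \<alpha> u where b: "b = (\<alpha>, u)" by (cases b)
    have "gidx k1 = (0, {k1})" using k1 nn by (simp add: gidx_def Y_simps)
    hence Eb: "E j b = (if \<alpha> = 0 \<and> u = {k1} \<and> j = i0 then 1 else 0)"
      by (simp add: E_def gfield_def vf_def gen1_gidx b)
    show "X j b = wscale (X i0 (0, {k1})) E j b"
    proof (cases "\<alpha> = 0 \<and> u = {k1} \<and> j = i0")
      case True
      thus ?thesis using Eb unfolding wscale_def lscale_apply b by simp
    next
      case False
      hence "X j b = 0" unfolding b using supp[of j \<alpha> u] by blast
      thus ?thesis unfolding wscale_def lscale_apply Eb using False by (simp only: if_False mult_zero_right)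
    qed
  qed
  thus ?thesis unfolding X_def H_def E_def .
qed

text \<open>D_{i0} kills x_{j0} x_{k1} and D_{j0} leaves x_{k1}, so the second argument is -x_{k1}
  D_{i0} for every admissible j0. This is why the scalar does not depend on j0.\<close>

lemma phi_Dij:
  assumes k0: "k0 \<in> Y0 m" and k1: "k1 \<in> Y1 m n" and i0: "i0 \<in> Y0 m" and j0: "j0 \<in> Y0 m"
    and ne: "i0 \<noteq> k0" "j0 \<noteq> i0"
  shows "\<phi> (Dij p m n t k0 k1 (lmult p m n t (gen m k0) (gen m k1)))
        (Dij p m n t i0 j0 (lmult p m n t (gen m j0) (gen m k1)))
      = wscale (\<phi> (torus k0 k1) (gfield k1 i0) i0 (0, {k1}))
          (bra (Dij p m n t k0 k1 (lmult p m n t (gen m k0) (gen m k1)))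
                      (Dij p m n t i0 j0 (lmult p m n t (gen m j0) (gen m k1))))"
proof -
  have Y: "k1 \<in> YY" "i0 \<in> YY" "k0 \<in> YY" "j0 \<in> YY" "j0 \<noteq> k1" "i0 \<noteq> k1" "k0 \<noteq> k1"
    "par m i0 = 0" "par m j0 = 0"
    using assms by (auto simp: Y_simps par_def tau_def)
  have 1: "Dij p m n t k0 k1 (lmult p m n t (gen m k0) (gen m k1)) = torus k0 k1"
    using Dij_torus[OF k0 k1] Y by (simp add: gen1_gen)
  have 2: "Dij p m n t i0 j0 (lmult p m n t (gen m j0) (gen m k1)) = - gfield k1 i0"
    using Dij_eq[OF M_hom[OF gen1_hom[of k1], of j0], of i0 j0] Y ne
    by (simp add: gen1_gen D_M gen1_Lam D_gen1 gfield_def)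
  have 3: "bra (torus k0 k1) (gfield k1 i0) = gfield k1 i0"
    using br_torus_gfield[OF k0 k1] Y ne by simp
  have "\<phi> (torus k0 k1) (- gfield k1 i0) = - \<phi> (torus k0 k1) (gfield k1 i0)"
    using torus_S[OF k0 k1] gfield_S[of k1 i0] Y by (intro phi_minus) auto
  thus ?thesis
    unfolding 1 2 bra_minus 3 using phi_multiple[OF k0 k1 i0 ne(1)] by simp
qed

end

end

theorem lemma4p9:
  fixes p m n :: nat
    and t :: "nat \<Rightarrow> nat"
    and \<phi> :: "(nat \<Rightarrow> idx \<Rightarrow> 'a::field) \<Rightarrow> (nat \<Rightarrow> idx \<Rightarrow> 'a) \<Rightarrow> (nat \<Rightarrow> idx \<Rightarrow> 'a)"
  assumes "CHAR('a) = p" and "p > 2"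
    and "m \<ge> 2" and "n \<ge> 2"
    and "\<forall>i\<in>Y0 m. t i > 0"
    and "skew_super_biderivation wscale (S p m n t) (S_hom p m n t) (br p m n t) \<phi>"
  shows "\<exists>lam :: nat \<Rightarrow> nat \<Rightarrow> nat \<Rightarrow> 'a.
    \<forall>k0\<in>Y0 m. \<forall>k1\<in>Y1 m n. \<forall>i0\<in>Y0 m. \<forall>j0\<in>Y0 m. i0 \<noteq> k0 \<longrightarrow> j0 \<noteq> i0 \<longrightarrow>
      \<phi> (Dij p m n t k0 k1 (lmult p m n t (gen m k0) (gen m k1)))
        (Dij p m n t i0 j0 (lmult p m n t (gen m j0) (gen m k1)))
      = wscale (lam k0 k1 i0)
          (br p m n t (Dij p m n t k0 k1 (lmult p m n t (gen m k0) (gen m k1)))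
                      (Dij p m n t i0 j0 (lmult p m n t (gen m j0) (gen m k1))))"
proof -
  interpret special_superalgebra p m n t "TYPE('a)"
    using assms by unfold_locales auto
  obtain \<gamma> where bil: "bilinear_on wscale SS \<phi>" and hom: "homogeneous_of_degree Sh \<gamma> \<phi>"
    and der: "\<forall>a b c. \<forall>x\<in>Sh a. \<forall>y\<in>Sh b. \<forall>z\<in>Sh c.
      \<phi> x (bra y z) = bra (\<phi> x y) z + psign ((\<gamma> + a) * b) (bra y (\<phi> x z))"
    and skew: "\<forall>a b. \<forall>x\<in>Sh a. \<forall>y\<in>Sh b.
      \<phi> x y = - psign (\<gamma> * a + \<gamma> * b + a * b) (\<phi> y x)"
    using assms(6) unfolding skew_super_biderivation_def wscale_sg by (elim conjE exE)
  note * = phi_Dij[OF bil hom der[rule_format] skew[rule_format]]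
  show ?thesis
    by (rule exI[of _ "\<lambda>k0 k1 i0. \<phi> (torus k0 k1) (gfield k1 i0) i0 (0, {k1})"])
       (intro ballI impI, rule *)
qed

end
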